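(* Let $h>0$ and, for $0\le s\le1$, let $$\ell_s=\Big\{u:\mathbb{Z}_h\to\mathbb{R}\;:\;\|u\|_{\ell_s}:=\sum_{m\in\mathbb{Z}}\frac{|u_m|}{(1+|m|)^{1+2s}}<\infty\Big\}.$$ (a) For $0<s<1$ and $u\in\ell_s$ we have, for every $j\in\mathbb{Z}$, $$(-\Delta_h)^su_j=\frac{1}{h^{2s}}\sum_{m\ne j}\big(u_j-u_m\big)K_s(j-m),$$ where the discrete kernel $K_s$ is given by $$K_s(m)=\frac{4^s\Gamma(1/2+s)\Gamma(|m|-s)}{\sqrt{\pi}\,|\Gamma(-s)|\,\Gamma(|m|+1+s)},\qquad m\in\mathbb{Z}\setminus\{0\}.$$ (b) If $u\in\ell_0$ then $\lim_{s\to0^+}(-\Delta_h)^su_j=u_j$ for every $j\in\mathbb{Z}$. If $u\in\ell^\infty$ then $\lim_{s\to1^-}(-\Delta_h)^su_j=-\Delta_hu_j$ for every $j\in\mathbb{Z}$. (c) For $0<s<1$ there exists a positive constant $C_s$ such that for all $m\in\mathbb{Z}\setminus\{0\}$, $$K_s(m)\le\frac{C_s}{|m|^{1+2s}}.$$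
   Context: $\mathbb{Z}_h=\{hj:j\in\mathbb{Z}\}$; a function on $\mathbb{Z}_h$ is written as a sequence $u_j$, $j\in\mathbb{Z}$; $\ell^\infty$ is the space of bounded such functions. The discrete Laplacian is $\Delta_hu_j=\frac{1}{h^2}(u_{j+1}-2u_j+u_{j-1})$. Its heat semigroup is $e^{t\Delta_h}u_j=\sum_{m\in\mathbb{Z}}G(j-m,\tfrac{t}{h^2})u_m$, $t\ge0$, where $G(m,t)=e^{-2t}I_m(2t)$ and $I_m$ is the modified Bessel function of the first kind of order $m\in\mathbb{Z}$ (this is the solution $w_j(t)$ of $\partial_tw_j=\Delta_hw_j$, $w_j(0)=u_j$). For $0<s<1$ the fractional discrete Laplacian is $$(-\Delta_h)^su_j=\frac{1}{\Gamma(-s)}\int_0^\infty\big(e^{t\Delta_h}u_j-u_j\big)\frac{dt}{t^{1+s}}.$$ *)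

theory Defs
  imports "HOL-Analysis.Analysis"
begin

text \<open>
  A function on the mesh of size \<open>h\<close> is represented by the sequence of its values:
  \<open>u j\<close> is the value at the mesh point \<open>h * j\<close>.
\<close>

definition discrete_laplacian :: "real \<Rightarrow> (int \<Rightarrow> real) \<Rightarrow> int \<Rightarrow> real" where
  "discrete_laplacian h u j = (u (j + 1) - 2 * u j + u (j - 1)) / h\<^sup>2"

text \<open>
  The usual series of the modified Bessel function of the first kind, at integer order.
  The terms with \<open>k + m < 0\<close> vanish because \<open>rGamma = 1 / Gamma\<close> is zero at the
  non-positive integers.
\<close>

definition bessel_I :: "int \<Rightarrow> real \<Rightarrow> real" where
  "bessel_I m x =
     (\<Sum>k. (x / 2) powi (2 * int k + m) * rGamma (real k + real_of_int m + 1) / fact k)"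

definition heat_kernel :: "int \<Rightarrow> real \<Rightarrow> real" where
  "heat_kernel m t = exp (- 2 * t) * bessel_I m (2 * t)"

definition heat_semigroup :: "real \<Rightarrow> real \<Rightarrow> (int \<Rightarrow> real) \<Rightarrow> int \<Rightarrow> real" where
  "heat_semigroup h t u j = (\<Sum>\<^sub>\<infinity>m\<in>UNIV. heat_kernel (j - m) (t / h\<^sup>2) * u m)"

definition fractional_laplacian :: "real \<Rightarrow> real \<Rightarrow> (int \<Rightarrow> real) \<Rightarrow> int \<Rightarrow> real" where
  "fractional_laplacian h s u j =
     1 / Gamma (- s) *
       (LINT t:{0<..}|lborel. (heat_semigroup h t u j - u j) / t powr (1 + s))"

definition ell :: "real \<Rightarrow> (int \<Rightarrow> real) set" where
  "ell s = {u. (\<lambda>m. \<bar>u m\<bar> / (1 + \<bar>real_of_int m\<bar>) powr (1 + 2 * s)) summable_on UNIV}"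

definition ell_infinity :: "(int \<Rightarrow> real) set" where
  "ell_infinity = {u. bounded (range u)}"

text \<open>Only the values at \<open>m \<noteq> 0\<close> are meaningful.\<close>

definition discrete_kernel :: "real \<Rightarrow> int \<Rightarrow> real" where
  "discrete_kernel s m =
     (4 powr s * Gamma (1 / 2 + s) * Gamma (\<bar>real_of_int m\<bar> - s)) /
     (sqrt pi * \<bar>Gamma (- s)\<bar> * Gamma (\<bar>real_of_int m\<bar> + 1 + s))"

end

theory Submission
  imports Defs
begin

text \<open>
  The heat kernel enters through one formula: for \<open>m \<noteq> 0\<close> the fractional kernel is, up to the factor
  \<open>\<bar>\<Gamma>(- s)\<bar>\<close>, the Mellin transform \<open>\<integral> G(m, t) t\<^sup>-\<^sup>1\<^sup>-\<^sup>s dt\<close> of the heat kernel (\<open>heat_kernel_Mellin\<close>). Integrating the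
  Bessel series term by term gives a series of quotients of Gamma values, which after Legendre's
  duplication formula is a Gauss series at argument \<open>1\<close>. Euler's proof of Gauss's summation theorem
  (\<open>Gauss_hypergeometric_sum\<close>) evaluates it: one Gamma quotient becomes a Beta integral, and the
  binomial series is summed under the integral sign. Everything is nonnegative, so all
  interchanges are instances of monotone convergence.

  To get the pointwise formula from this, note that the heat kernel has total mass \<open>1\<close> (\<open>heat_kernel_has_sum\<close>), because
  \<open>e\<^sup>2\<^sup>t\<close> is the product of two exponential series whose terms are regrouped by the difference
  of their indices. So \<open>e\<^sup>t\<^sup>\<Delta> u - u\<close> at \<open>j\<close> is the sum of \<open>G(j - m, t/h\<^sup>2) (u m - u j)\<close>, and Fubini's
  theorem exchanges this sum with the integral over \<open>t\<close>. The absolute convergence that Fubini asks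
  for is the decay of the kernel together with the definition of \<open>\<ell>\<^sub>s\<close>.

  The decay comes from log-convexity of the Gamma function, which gives
  \<open>\<Gamma>(m - s) / \<Gamma>(m + 1 + s) \<le> (m - s)\<^sup>-\<^sup>1\<^sup>-\<^sup>2\<^sup>s\<close>. This bound is uniform enough in \<open>s\<close> for the limits as well:
  the remaining factor of the kernel, \<open>kernel_constant s\<close>, tends to \<open>0\<close> both for \<open>s \<rightarrow> 0\<close> and for
  \<open>s \<rightarrow> 1\<close>. As \<open>s \<rightarrow> 0\<close> the part \<open>\<Sum> u m K\<^sub>s(j - m)\<close> therefore vanishes, while the total mass of the
  kernel, computed by a telescoping sum (\<open>discrete_kernel_has_sum\<close>), tends to \<open>1\<close>, so only \<open>u j\<close>
  survives. As \<open>s \<rightarrow> 1\<close> the part of the sum over \<open>\<bar>j - m\<bar> \<ge> 2\<close> vanishes, while \<open>K\<^sub>s(1)\<close> and \<open>K\<^sub>s(-1)\<close> tend to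
  \<open>1\<close>, because there the pole of \<open>\<Gamma>(1 - s)\<close> compensates the zero of the factor; the two nearest
  neighbours make up the discrete Laplacian.
\<close>

section \<open>Gamma function estimates and Gauss's summation theorem\<close>

lemma nn_integral_cmult_ennreal:
  fixes f :: "'a \<Rightarrow> real"
  assumes "f \<in> borel_measurable M" "c \<ge> 0"
  shows "(\<integral>\<^sup>+x. ennreal (c * f x) \<partial>M) = ennreal c * (\<integral>\<^sup>+x. ennreal (f x) \<partial>M)"
  using assms by (simp add: ennreal_mult' nn_integral_cmult)

lemma Beta_conv_nn_integral_real:
  assumes "a > 0" "b > (0::real)"
  shows "(\<integral>\<^sup>+x. ennreal (indicator {0..1} x * (x powr (a - 1) * (1 - x) powr (b - 1))) \<partial>lborel)
           = ennreal (Beta a b)"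
  using nn_integral_has_integral_lebesgue[OF _ has_integral_Beta_real[OF assms]] by simp

text \<open>
  This is the binomial series for the exponent \<open>- a\<close>: the signs of \<open>- a gchoose k\<close> and of \<open>(- x) ^ k\<close>
  cancel, and the rising factorial that remains is a quotient of Gamma values.
\<close>

lemma negative_binomial_series:
  fixes a x :: real
  assumes "a > 0" "\<bar>x\<bar> < 1"
  shows "(\<lambda>k. Gamma (real k + a) / fact k * x ^ k) sums (Gamma a * (1 - x) powr (- a))"
proof -
  have a: "a \<notin> \<int>\<^sub>\<le>\<^sub>0"
    using assms(1) by (auto elim!: nonpos_Ints_cases)
  have "(\<lambda>k. Gamma a * ((- a gchoose k) * (- x) ^ k)) sums (Gamma a * (1 + - x) powr (- a))"
    using assms by (intro sums_mult gen_binomial_real) auto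
  moreover have "Gamma a * ((- a gchoose k) * (- x) ^ k) = Gamma (real k + a) / fact k * x ^ k" for k
    using a assms(1)
    by (simp add: gbinomial_pochhammer pochhammer_Gamma power_mult_distrib [symmetric] add.commute Gamma_eq_zero_iff)
  ultimately show ?thesis by simp
qed

text \<open>
  Gauss's value of \<open>F(a, b; c; 1)\<close>, by Euler's argument. Up to the factor \<open>\<Gamma>(c - b)\<close>, the quotient
  \<open>\<Gamma>(k + b) / \<Gamma>(k + c)\<close> is the Beta integral of \<open>x\<^sup>k\<^sup>+\<^sup>b\<^sup>-\<^sup>1 (1 - x)\<^sup>c\<^sup>-\<^sup>b\<^sup>-\<^sup>1\<close>. Summing the
  binomial series under the integral multiplies the weight by \<open>(1 - x)\<^sup>-\<^sup>a\<close>, which leaves the Beta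
  integral with parameters \<open>b\<close> and \<open>c - a - b\<close>.
\<close>

lemma Gauss_hypergeometric_sum:
  fixes a b c :: real
  assumes "a > 0" "b > 0" "c > a + b"
  shows "(\<lambda>k. Gamma (real k + a) * Gamma (real k + b) / (fact k * Gamma (real k + c)))
           sums (Gamma a * Gamma b * Gamma (c - a - b) / (Gamma (c - a) * Gamma (c - b)))"
proof -
  define w where "w = (\<lambda>x::real. indicator {0..1} x * (x powr (b - 1) * (1 - x) powr (c - b - 1)))"
  define p where "p = (\<lambda>k x. Gamma (real k + a) / fact k * x ^ k :: real)"
  have w_nonneg: "w x \<ge> 0" for x by (simp add: w_def)
  have p_nonneg: "p k x * w x \<ge> 0" for k x
    using assms by (auto simp: p_def w_def indicator_def intro!: mult_nonneg_nonneg divide_nonneg_nonneg Gamma_real_nonneg)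
  have term_integral: "(\<integral>\<^sup>+x. ennreal (p k x * w x) \<partial>lborel)
      = ennreal (Gamma (real k + a) / fact k * Beta (real k + b) (c - b))" for k
  proof -
    have "p k x * w x = Gamma (real k + a) / fact k *
        (indicator {0..1} x * (x powr (real k + b - 1) * (1 - x) powr (c - b - 1)))" for x
    proof (cases "0 < x")
      case True
      then have "x powr (real k + b - 1) = x ^ k * x powr (b - 1)"
        by (simp add: powr_realpow [symmetric] powr_add [symmetric] algebra_simps)
      then show ?thesis by (simp add: p_def w_def)
    qed (auto simp: p_def w_def indicator_def)
    moreover have nonneg: "Gamma (real k + a) / fact k \<ge> 0"
      using assms by (intro divide_nonneg_nonneg Gamma_real_nonneg) auto
    ultimately have "(\<integral>\<^sup>+x. ennreal (p k x * w x) \<partial>lborel) = ennreal (Gamma (real k + a) / fact k) *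
        (\<integral>\<^sup>+x. ennreal (indicator {0..1} x *
          (x powr (real k + b - 1) * (1 - x) powr (c - b - 1))) \<partial>lborel)"
      by (subst nn_integral_cmult_ennreal [symmetric]) simp_all
    also have "\<dots> = ennreal (Gamma (real k + a) / fact k) * ennreal (Beta (real k + b) (c - b))"
      using assms by (subst Beta_conv_nn_integral_real) simp_all
    finally show ?thesis
      using nonneg by (simp only: ennreal_mult')
  qed
  have integrand_sum: "(\<Sum>k. ennreal (p k x * w x)) = ennreal (Gamma a *
      (indicator {0..1} x * (x powr (b - 1) * (1 - x) powr (c - a - b - 1))))" for x
  proof (cases "0 < x \<and> x < 1")
    case True
    then have "(\<lambda>k. p k x * w x) sums (Gamma a * (1 - x) powr (- a) * w x)"
      unfolding p_def using assms by (intro sums_mult2 negative_binomial_series) auto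
    moreover have "(1 - x) powr (- a) * (1 - x) powr (c - b - 1) = (1 - x) powr (c - a - b - 1)"
      by (simp add: powr_add [symmetric] algebra_simps)
    ultimately have "(\<lambda>k. p k x * w x) sums (Gamma a *
        (indicator {0..1} x * (x powr (b - 1) * (1 - x) powr (c - a - b - 1))))"
      using True by (simp add: w_def mult_ac)
    with p_nonneg show ?thesis by (rule suminf_ennreal_eq)
  next
    \<comment> \<open>The series diverges at \<open>x = 1\<close>, but the weight is \<open>0\<close> there because \<open>0 powr p = 0\<close> for every \<open>p\<close>.\<close>
    case False
    then have "w x = 0" "indicator {0..1} x * (x powr (b - 1) * (1 - x) powr (c - a - b - 1)) = 0"
      by (auto simp: w_def indicator_def)
    then show ?thesis by (simp only:) simp
  qed
  have "(\<Sum>k. ennreal (Gamma (real k + a) / fact k * Beta (real k + b) (c - b)))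
      = (\<integral>\<^sup>+x. (\<Sum>k. ennreal (p k x * w x)) \<partial>lborel)"
    unfolding term_integral [symmetric]
    by (rule nn_integral_suminf [symmetric]) (simp add: p_def w_def)
  also have "\<dots> = ennreal (Gamma a * Beta b (c - a - b))"
    using assms Beta_conv_nn_integral_real[of b "c - a - b"] Gamma_real_nonneg[of a]
    by (subst integrand_sum, subst nn_integral_cmult_ennreal) (simp_all add: Beta_conv_nn_integral_real ennreal_mult' Gamma_real_nonneg)
  finally have "(\<lambda>k. ennreal (Gamma (real k + a) / fact k * Beta (real k + b) (c - b)))
      sums ennreal (Gamma a * Beta b (c - a - b))"
    by (simp only: sums_iff summableI simp_thms)
  moreover have "Gamma (real k + a) / fact k * Beta (real k + b) (c - b) \<ge> 0" for k
    using assms unfolding Beta_def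
    by (intro mult_nonneg_nonneg divide_nonneg_nonneg Gamma_real_nonneg) auto
  moreover have "Gamma a * Beta b (c - a - b) \<ge> 0"
    using assms unfolding Beta_def
    by (intro mult_nonneg_nonneg divide_nonneg_nonneg Gamma_real_nonneg) auto
  ultimately have "(\<lambda>k. Gamma (real k + a) / fact k * Beta (real k + b) (c - b))
      sums (Gamma a * Beta b (c - a - b))"
    by (simp add: sums_ennreal)
  then have "(\<lambda>k. Gamma (real k + a) / fact k * Beta (real k + b) (c - b) / Gamma (c - b))
      sums (Gamma a * Beta b (c - a - b) / Gamma (c - b))"
    by (rule sums_divide)
  moreover have "Gamma (c - b) \<noteq> 0"
    using assms by (auto simp: Gamma_eq_zero_iff elim!: nonpos_Ints_cases)
  ultimately show ?thesis by (simp add: Beta_def algebra_simps)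
qed

lemma Gamma_legendre_duplication_real:
  fixes z :: real
  assumes "z > 0"
  shows "Gamma (z / 2) * Gamma ((z + 1) / 2) = 2 powr (1 - z) * sqrt pi * Gamma z"
proof -
  have "complex_of_real (z / 2) \<notin> \<int>\<^sub>\<le>\<^sub>0" "complex_of_real (z / 2) + 1 / 2 \<notin> \<int>\<^sub>\<le>\<^sub>0"
    using assms by (auto elim!: nonpos_Ints_cases simp: complex_eq_iff)
  from Gamma_legendre_duplication[OF this]
  have "complex_of_real (Gamma (z / 2) * Gamma ((z + 1) / 2)) =
      complex_of_real (exp ((1 - z) * ln 2) * sqrt pi * Gamma z)"
    by (simp add: Gamma_complex_of_real [symmetric] add_divide_distrib exp_of_real [symmetric])
  then show ?thesis
    by (simp only: of_real_eq_iff) (simp add: powr_def)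
qed

lemma Gamma_plus1_real_pos:
  fixes x :: real
  assumes "x > 0"
  shows "Gamma (x + 1) = x * Gamma x"
  using assms by (intro Gamma_plus1) (auto elim!: nonpos_Ints_cases)

text \<open>
  The point \<open>x + 1\<close> lies between \<open>x\<close> and \<open>x + a\<close>, at the fraction \<open>1 / a\<close> of the way. Log-convexity of
  the Gamma function there reads \<open>(x \<Gamma>(x))\<^sup>a \<le> \<Gamma>(x)\<^sup>a\<^sup>-\<^sup>1 \<Gamma>(x + a)\<close>.
\<close>

lemma powr_times_Gamma_le:
  fixes x a :: real
  assumes "x > 0" "a \<ge> 1"
  shows "x powr a * Gamma x \<le> Gamma (x + a)"
proof -
  have G: "Gamma x \<noteq> 0"
    using Gamma_real_pos[OF assms(1)] by linarith
  have "(ln \<circ> Gamma) ((1 - 1 / a) *\<^sub>R x + (1 / a) *\<^sub>R (x + a))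
      \<le> (1 - 1 / a) * (ln \<circ> Gamma) x + 1 / a * (ln \<circ> Gamma) (x + a)"
    using assms by (intro convex_onD[OF log_convex_Gamma_real]) auto
  moreover have "(1 - 1 / a) *\<^sub>R x + (1 / a) *\<^sub>R (x + a) = x + 1"
    using assms by (simp add: field_simps)
  ultimately have "ln (Gamma (x + 1)) \<le> (1 - 1 / a) * ln (Gamma x) + 1 / a * ln (Gamma (x + a))"
    by (simp only: o_def)
  moreover have "Gamma (x + 1) = x * Gamma x"
    using assms by (intro Gamma_plus1_real_pos)
  moreover have "ln (x * Gamma x) = ln x + ln (Gamma x)"
    using assms G by (simp add: ln_mult)
  ultimately have "ln x + ln (Gamma x) \<le> (1 - 1 / a) * ln (Gamma x) + 1 / a * ln (Gamma (x + a))"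
    by simp
  then have "a * (ln x + ln (Gamma x))
      \<le> a * ((1 - 1 / a) * ln (Gamma x) + 1 / a * ln (Gamma (x + a)))"
    using assms by (intro mult_left_mono) auto
  also have "\<dots> = (a - 1) * ln (Gamma x) + ln (Gamma (x + a))"
    using assms by (simp add: algebra_simps)
  finally have "a * ln x + ln (Gamma x) \<le> ln (Gamma (x + a))"
    by (simp add: algebra_simps)
  moreover have "ln (x powr a * Gamma x) = a * ln x + ln (Gamma x)"
    using assms G by (simp add: ln_mult ln_powr)
  ultimately have "ln (x powr a * Gamma x) \<le> ln (Gamma (x + a))"
    by simp
  moreover have "x powr a * Gamma x > 0" "Gamma (x + a) > 0"
    using assms by simp_all
  ultimately show ?thesis by simp
qed

lemma Gamma_one_minus:
  fixes s :: real
  assumes "0 < s" "s < 1"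
  shows "Gamma (1 - s) = - s * Gamma (- s)"
proof -
  have "- s \<notin> \<int>\<^sub>\<le>\<^sub>0"
  proof
    assume "- s \<in> \<int>\<^sub>\<le>\<^sub>0"
    then obtain n where "- s = real_of_int n"
      by (elim nonpos_Ints_cases)
    with assms have "- 1 < n" "n < 0"
      by linarith+
    then show False by simp
  qed
  then show ?thesis
    using Gamma_plus1[of "- s"] by simp
qed

lemma Gamma_minus_neg:
  fixes s :: real
  assumes "0 < s" "s < 1"
  shows "Gamma (- s) < 0"
proof -
  have "Gamma (1 - s) > 0" using assms by simp
  then show ?thesis using assms by (simp add: Gamma_one_minus mult_less_0_iff)
qed

lemma Gamma_ratio_le:
  fixes x s :: real
  assumes "0 < s" "s < x"
  shows "Gamma (x - s) / Gamma (x + 1 + s) \<le> (x - s) powr (- (1 + 2 * s))"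
proof -
  have "(x - s) powr (1 + 2 * s) * Gamma (x - s) \<le> Gamma (x + 1 + s)"
    using powr_times_Gamma_le[of "x - s" "1 + 2 * s"] assms by (simp add: algebra_simps)
  moreover have "(x - s) powr (1 + 2 * s) > 0" "Gamma (x + 1 + s) > 0"
    using assms by auto
  ultimately show ?thesis
    unfolding powr_minus_divide by (simp add: divide_simps mult.commute)
qed

text \<open>
  The series telescopes: with \<open>f(n) = \<Gamma>(n + 1 - s) / \<Gamma>(n + 1 + s)\<close>, the functional equation gives
  \<open>f(n) - f(n + 1) = ((n + 1 + s) - (n + 1 - s)) \<Gamma>(n + 1 - s) / \<Gamma>(n + 2 + s)\<close>, and \<open>f\<close> decays like
  \<open>n\<^sup>-\<^sup>2\<^sup>s\<close>.
\<close>

lemma Gamma_ratio_sums: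
  fixes s :: real
  assumes "0 < s" "s < 1"
  shows "(\<lambda>n. Gamma (real n + 1 - s) / Gamma (real n + 2 + s))
           sums (Gamma (1 - s) / (2 * s * Gamma (1 + s)))"
proof -
  define f where "f = (\<lambda>n. Gamma (real n + 1 - s) / Gamma (real n + 1 + s))"
  have shift: "Gamma (real n + 2 + s) = (real n + 1 + s) * Gamma (real n + 1 + s)"
      "Gamma (real n + 2 - s) = (real n + 1 - s) * Gamma (real n + 1 - s)" for n
    using Gamma_plus1_real_pos[of "real n + 1 + s"] Gamma_plus1_real_pos[of "real n + 1 - s"] assms
    by (simp_all add: add_ac diff_add_eq add_diff_eq)
  have pos: "Gamma (real n + 1 - s) > 0" "Gamma (real n + 1 + s) > 0" "Gamma (real n + 2 + s) > 0" for n
    using assms by auto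
  have diff: "f n - f (Suc n) = 2 * s * (Gamma (real n + 1 - s) / Gamma (real n + 2 + s))" for n
  proof -
    have "f (Suc n) = Gamma (real n + 2 - s) / Gamma (real n + 2 + s)"
      by (simp add: f_def algebra_simps)
    also have "f n - \<dots> = 2 * s * (Gamma (real n + 1 - s) / Gamma (real n + 2 + s))"
      unfolding f_def shift using pos[of n] assms by (simp add: divide_simps) (simp add: algebra_simps)
    finally show ?thesis .
  qed
  have f_bounds: "0 \<le> f n \<and> f n \<le> 2 / (real n + 1 - s) powr (2 * s) / (1 - s)" for n
  proof -
    have "f n = (real n + 1 + s) * (Gamma (real n + 1 - s) / Gamma (real n + 1 + 1 + s))"
      using shift(1)[of n] pos[of n] assms by (simp add: f_def add.commute add.left_commute)
    also have "\<dots> \<le> (real n + 1 + s) * (real n + 1 - s) powr (- (1 + 2 * s))"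
      using assms by (intro mult_left_mono Gamma_ratio_le) auto
    also have "\<dots> \<le> (2 / (1 - s) * (real n + 1 - s)) * (real n + 1 - s) powr (- (1 + 2 * s))"
    proof (intro mult_right_mono)
      have "(real n + 1 + s) * (1 - s) \<le> 2 * (real n + 1 - s)"
      proof -
        have "2 * (real n + 1 - s) - (real n + 1 + s) * (1 - s) = real n * (1 + s) + (1 - s)\<^sup>2"
          by (simp add: power2_eq_square algebra_simps)
        also have "\<dots> \<ge> 0" using assms by simp
        finally show ?thesis by simp
      qed
      then show "real n + 1 + s \<le> 2 / (1 - s) * (real n + 1 - s)"
        using assms by (simp add: field_simps)
    qed auto
    also have "\<dots> = 2 / (real n + 1 - s) powr (2 * s) / (1 - s)"
    proof -
      have "(real n + 1 - s) * (real n + 1 - s) powr (- (1 + 2 * s)) = 1 / (real n + 1 - s) powr (2 * s)"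
        using assms unfolding powr_minus_divide powr_add by simp
      then show ?thesis by (simp only: mult.assoc) simp
    qed
    finally show ?thesis using pos[of n] by (simp add: f_def)
  qed
  have "(\<lambda>n. 2 / (real n + 1 - s) powr (2 * s) / (1 - s)) \<longlonglongrightarrow> 0"
  proof -
    have "filterlim (\<lambda>n. real n + (1 - s)) at_top sequentially"
      using filterlim_tendsto_add_at_top[OF tendsto_const filterlim_real_sequentially, of "1 - s"]
      by (simp add: add.commute)
    then have "(\<lambda>n. (real n + (1 - s)) powr (- (2 * s))) \<longlonglongrightarrow> 0"
      using assms by (intro tendsto_neg_powr) auto
    then have "(\<lambda>n. 2 / (1 - s) * (real n + (1 - s)) powr (- (2 * s))) \<longlonglongrightarrow> 2 / (1 - s) * 0"
      by (intro tendsto_mult_left)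
    then show ?thesis by (simp add: powr_minus_divide algebra_simps)
  qed
  then have "f \<longlonglongrightarrow> 0"
    by (rule tendsto_sandwich[OF _ _ tendsto_const, rotated 2]) (use f_bounds in auto)
  then have "(\<lambda>n. f n - f (Suc n)) sums (f 0 - 0)"
    by (rule telescope_sums')
  then have "(\<lambda>n. 2 * s * (Gamma (real n + 1 - s) / Gamma (real n + 2 + s)) / (2 * s))
      sums ((f 0 - 0) / (2 * s))"
    unfolding diff by (rule sums_divide)
  then show ?thesis using assms by (simp add: f_def mult_ac)
qed

section \<open>The kernel of the fractional discrete Laplacian\<close>

lemma isCont_tendsto_within: "isCont f a \<Longrightarrow> (f \<longlongrightarrow> f a) (at a within A)"
  using continuous_at_imp_continuous_at_within continuous_within by blast

text \<open>
  The factor of \<open>discrete_kernel s m\<close> that does not depend on \<open>m\<close>. Since \<open>\<bar>\<Gamma>(- s)\<bar> = \<Gamma>(1 - s) / s\<close>, it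
  can be written with the entire function \<open>rGamma\<close>; in this form it is continuous on the closed
  interval from \<open>0\<close> to \<open>1\<close> and visibly vanishes at both ends.
\<close>

definition kernel_constant :: "real \<Rightarrow> real" where
  "kernel_constant s = s * 4 powr s * Gamma (1 / 2 + s) * rGamma (1 - s) / sqrt pi"

lemma discrete_kernel_conv_constant:
  assumes "0 < s" "s < 1"
  shows "discrete_kernel s m =
           kernel_constant s * (Gamma (\<bar>real_of_int m\<bar> - s) / Gamma (\<bar>real_of_int m\<bar> + 1 + s))"
  using assms
  by (simp add: discrete_kernel_def kernel_constant_def rGamma_inverse_Gamma Gamma_one_minus abs_of_neg Gamma_minus_neg
        field_simps)

lemma discrete_kernel_even [simp]: "discrete_kernel s (- m) = discrete_kernel s m"
  by (simp add: discrete_kernel_def)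

lemma kernel_constant_pos:
  assumes "0 < s" "s < 1"
  shows "kernel_constant s > 0"
  using assms unfolding kernel_constant_def rGamma_inverse_Gamma
  by (intro divide_pos_pos mult_pos_pos) auto

lemma kernel_constant_tendsto_0:
  shows "(kernel_constant \<longlongrightarrow> 0) (at_right 0)" "(kernel_constant \<longlongrightarrow> 0) (at_left 1)"
proof -
  have *: "isCont kernel_constant s" if "s \<ge> 0" for s
    using that unfolding kernel_constant_def
    by (intro continuous_intros) (auto elim!: nonpos_Ints_cases)
  show "(kernel_constant \<longlongrightarrow> 0) (at_right 0)"
    using *[of 0] by (auto simp: isCont_def kernel_constant_def intro: tendsto_mono[OF at_le])
  show "(kernel_constant \<longlongrightarrow> 0) (at_left 1)"
    using *[of 1] by (auto simp: isCont_def kernel_constant_def intro: tendsto_mono[OF at_le])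
qed

lemma abs_int_ge_1: "m \<noteq> 0 \<Longrightarrow> \<bar>real_of_int m\<bar> \<ge> 1"
  by linarith

lemma discrete_kernel_nonneg:
  assumes "0 < s" "s < 1" "m \<noteq> 0"
  shows "discrete_kernel s m \<ge> 0"
  using assms kernel_constant_pos[of s] abs_int_ge_1[of m]
  by (auto simp: discrete_kernel_conv_constant intro!: mult_nonneg_nonneg divide_nonneg_nonneg
        Gamma_real_nonneg)

text \<open>
  Keeping \<open>\<bar>m\<bar> - s\<close> as the base, instead of a multiple of \<open>\<bar>m\<bar>\<close>, leaves \<open>kernel_constant s\<close> as the only
  constant. This is what makes the bound strong enough for the limits \<open>s \<rightarrow> 0\<close> and \<open>s \<rightarrow> 1\<close>.
\<close>

lemma discrete_kernel_le:
  assumes "0 < s" "s < 1" "m \<noteq> 0"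
  shows "discrete_kernel s m \<le> kernel_constant s * (\<bar>real_of_int m\<bar> - s) powr (- (1 + 2 * s))"
  unfolding discrete_kernel_conv_constant[OF assms(1,2)]
  using assms kernel_constant_pos[of s] abs_int_ge_1[of m]
  by (intro mult_left_mono Gamma_ratio_le) auto

lemma discrete_kernel_decay:
  assumes "0 < s" "s < 1" "m \<noteq> 0"
  shows "discrete_kernel s m
           \<le> kernel_constant s * (1 - s) powr (- (1 + 2 * s)) / \<bar>real_of_int m\<bar> powr (1 + 2 * s)"
proof -
  have "s * 1 \<le> s * \<bar>real_of_int m\<bar>"
    using assms abs_int_ge_1[of m] by (intro mult_left_mono) auto
  then have "(\<bar>real_of_int m\<bar> - s) powr (- (1 + 2 * s))
      \<le> ((1 - s) * \<bar>real_of_int m\<bar>) powr (- (1 + 2 * s))"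
    using assms by (intro powr_mono2') (auto simp: algebra_simps)
  also have "\<dots> = (1 - s) powr (- (1 + 2 * s)) / \<bar>real_of_int m\<bar> powr (1 + 2 * s)"
    using assms unfolding powr_minus_divide by (simp add: powr_mult)
  finally have "kernel_constant s * (\<bar>real_of_int m\<bar> - s) powr (- (1 + 2 * s))
      \<le> kernel_constant s * ((1 - s) powr (- (1 + 2 * s)) / \<bar>real_of_int m\<bar> powr (1 + 2 * s))"
    using kernel_constant_pos[of s] assms by (intro mult_left_mono) auto
  with discrete_kernel_le[OF assms] show ?thesis by simp
qed

lemma has_sum_even_int:
  fixes f :: "int \<Rightarrow> real"
  assumes even: "\<And>m. f (- m) = f m" and sum: "((\<lambda>n. f (int n + 1)) has_sum S) UNIV"
  shows "(f has_sum (2 * S)) (UNIV - {0})"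
proof -
  have "(f has_sum S) {0<..}"
    using sum by (subst has_sum_reindex_bij_witness[of _ "\<lambda>n. int n + 1" "\<lambda>m. nat (m - 1)" UNIV "\<lambda>n. f (int n + 1)"]) auto
  moreover have "(f has_sum S) {..<0}"
    using sum even
    by (subst has_sum_reindex_bij_witness[of _ "\<lambda>n. - (int n + 1)" "\<lambda>m. nat (- m - 1)" UNIV "\<lambda>n. f (int n + 1)"])
      (auto simp: even minus_add_distrib simp del: add_uminus_conv_diff)
  ultimately have "(f has_sum (S + S)) ({0<..} \<union> {..<0})"
    by (intro has_sum_Un_disjoint) auto
  moreover have "{0<..} \<union> {..<0} = UNIV - {0::int}" by auto
  ultimately show ?thesis by simp
qed

text \<open>
  By symmetry the total mass is twice the sum over the positive integers, which is the telescoping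
  series \<open>Gamma_ratio_sums\<close>. Its value is continuous at \<open>s = 0\<close>, where it equals \<open>1\<close>.
\<close>

lemma discrete_kernel_has_sum:
  assumes "0 < s" "s < 1"
  shows "(discrete_kernel s has_sum (4 powr s * Gamma (1 / 2 + s) / (sqrt pi * Gamma (1 + s)))) (UNIV - {0})"
proof -
  have "(\<lambda>n. kernel_constant s * (Gamma (real n + 1 - s) / Gamma (real n + 2 + s)))
      sums (kernel_constant s * (Gamma (1 - s) / (2 * s * Gamma (1 + s))))"
    using assms by (intro sums_mult Gamma_ratio_sums)
  then have "(\<lambda>n. discrete_kernel s (int n + 1))
      sums (kernel_constant s * (Gamma (1 - s) / (2 * s * Gamma (1 + s))))"
    using assms by (simp add: discrete_kernel_conv_constant algebra_simps)
  then have "((\<lambda>n. discrete_kernel s (int n + 1))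
      has_sum (kernel_constant s * (Gamma (1 - s) / (2 * s * Gamma (1 + s))))) UNIV"
    using assms by (intro sums_nonneg_imp_has_sum discrete_kernel_nonneg) auto
  then have "(discrete_kernel s has_sum
      (2 * (kernel_constant s * (Gamma (1 - s) / (2 * s * Gamma (1 + s)))))) (UNIV - {0})"
    by (intro has_sum_even_int) auto
  also have "2 * (kernel_constant s * (Gamma (1 - s) / (2 * s * Gamma (1 + s)))) =
      4 powr s * Gamma (1 / 2 + s) / (sqrt pi * Gamma (1 + s))"
  proof -
    have "Gamma (1 - s) \<noteq> 0"
      using assms Gamma_real_pos[of "1 - s"] by linarith
    then show ?thesis
      using assms by (simp add: kernel_constant_def rGamma_inverse_Gamma)
  qed
  finally show ?thesis .
qed

text \<open>
  At \<open>m = 1\<close> the numerator \<open>\<Gamma>(1 - s)\<close> of the kernel cancels \<open>rGamma (1 - s)\<close> in \<open>kernel_constant s\<close>. The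
  cancelled form is continuous at \<open>s = 1\<close>, with value \<open>4 \<Gamma>(3/2) / (\<surd>\<pi> \<Gamma>(3)) = 1\<close>.
\<close>

lemma discrete_kernel_1_tendsto: "((\<lambda>s. discrete_kernel s 1) \<longlongrightarrow> 1) (at_left 1)"
proof -
  define F where "F = (\<lambda>s::real. s * 4 powr s * Gamma (1 / 2 + s) / (sqrt pi * Gamma (2 + s)))"
  have "isCont F 1"
    unfolding F_def by (intro continuous_intros) (auto elim!: nonpos_Ints_cases simp: Gamma_eq_zero_iff)
  moreover have "F 1 = 1"
  proof -
    have "Gamma (3 / 2 :: real) = sqrt pi / 2"
      using Gamma_plus1_real_pos[of "1 / 2"] by (simp add: Gamma_one_half_real)
    moreover have "Gamma (3 :: real) = 2"
      using Gamma_fact[of 2, where ?'a = real] by (simp add: fact_numeral)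
    ultimately show ?thesis by (simp add: F_def)
  qed
  ultimately have "(F \<longlongrightarrow> 1) (at_left 1)"
    using isCont_tendsto_within[of 1 F] by simp
  moreover have "eventually (\<lambda>s. discrete_kernel s 1 = F s) (at_left 1)"
    using eventually_at_left_real[of 0 1, OF zero_less_one]
  proof eventually_elim
    case (elim s)
    then have "Gamma (1 - s) \<noteq> 0"
      using Gamma_real_pos[of "1 - s"] by (simp add: less_imp_neq [symmetric] del: Gamma_real_pos)
    with elim show ?case
      by (simp add: discrete_kernel_conv_constant kernel_constant_def F_def rGamma_inverse_Gamma)
  qed
  ultimately show ?thesis by (simp add: tendsto_cong)
qed

section \<open>The heat kernel on the integers\<close>

text \<open>
  The coefficients of the exponential series, extended by zero to negative indices. The Bessel
  series of order \<open>m\<close> is then the correlation \<open>\<Sum>k. exp_coeff t k * exp_coeff t (k + m)\<close> for either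
  sign of \<open>m\<close>, and summing it over all \<open>m\<close> is a translation in the integers.
\<close>

definition exp_coeff :: "real \<Rightarrow> int \<Rightarrow> real" where
  "exp_coeff t a = (if a \<ge> 0 then t ^ nat a / fact (nat a) else 0)"

lemma exp_coeff_nonneg: "t \<ge> 0 \<Longrightarrow> exp_coeff t a \<ge> 0"
  by (simp add: exp_coeff_def)

lemma exp_coeff_nat: "exp_coeff t (int k) = t ^ k / fact k"
  by (simp add: exp_coeff_def)

lemma exp_coeff_sums: "(\<lambda>k. exp_coeff t (int k)) sums exp t"
  using exp_converges[of t] by (simp add: exp_coeff_nat scaleR_conv_of_real divide_inverse mult.commute)

lemma exp_coeff_le_exp:
  assumes "t \<ge> 0"
  shows "exp_coeff t a \<le> exp t"
proof (cases "a \<ge> 0")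
  case True
  have "sum (\<lambda>k. exp_coeff t (int k)) {nat a} \<le> suminf (\<lambda>k. exp_coeff t (int k))"
    using assms exp_coeff_sums[of t] by (intro sum_le_suminf) (auto simp: sums_iff exp_coeff_nonneg)
  with True show ?thesis
    using exp_coeff_sums[of t] by (simp add: sums_iff)
qed (simp add: exp_coeff_def)

lemma exp_coeff_has_sum:
  assumes "t \<ge> 0"
  shows "(exp_coeff t has_sum exp t) UNIV"
proof -
  have "((\<lambda>k. exp_coeff t (int k)) has_sum exp t) UNIV"
    using exp_coeff_sums assms by (intro sums_nonneg_imp_has_sum) (auto intro: exp_coeff_nonneg)
  then have "(exp_coeff t has_sum exp t) {0..}"
    by (subst has_sum_reindex_bij_witness[of _ int nat UNIV "\<lambda>k. exp_coeff t (int k)"]) auto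
  then show ?thesis
    by (subst has_sum_cong_neutral[of "{0..}" UNIV "exp_coeff t" "exp_coeff t"]) (auto simp: exp_coeff_def)
qed

lemma bessel_I_sums:
  assumes "t \<ge> 0"
  shows "(\<lambda>k. exp_coeff t (int k) * exp_coeff t (int k + m)) sums bessel_I m (2 * t)"
proof -
  have "summable (\<lambda>k. exp_coeff t (int k) * exp_coeff t (int k + m))"
  proof (rule summable_comparison_test')
    show "summable (\<lambda>k. exp_coeff t (int k) * exp t)"
      using sums_mult2[OF exp_coeff_sums[of t], of "exp t"] by (simp add: sums_iff)
    show "norm (exp_coeff t (int k) * exp_coeff t (int k + m)) \<le> exp_coeff t (int k) * exp t" if "k \<ge> 0" for k
      using assms by (auto simp: exp_coeff_nonneg abs_mult intro!: mult_left_mono exp_coeff_le_exp)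
  qed
  moreover have "exp_coeff t (int k) * exp_coeff t (int k + m) =
      t powi (2 * int k + m) * rGamma (real k + real_of_int m + 1) / fact k" for k
  proof -
    have G: "rGamma (real k + real_of_int m + 1) =
        (if int k + m \<ge> 0 then inverse (fact (nat (int k + m))) else 0)"
      using rGamma_of_int[of "int k + m + 1", where ?'a = real] by simp
    show ?thesis
    proof (cases "int k + m \<ge> 0")
      case True
      then have "2 * int k + m = int (k + nat (int k + m))" by simp
      then have "t powi (2 * int k + m) = t ^ k * t ^ nat (int k + m)"
        by (metis power_add power_int_of_nat)
      moreover have "exp_coeff t (int k + m) = t ^ nat (int k + m) / fact (nat (int k + m))"
        using True by (simp only: exp_coeff_def if_True)
      moreover have "rGamma (real k + real_of_int m + 1) = inverse (fact (nat (int k + m)))"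
        using True by (simp only: G if_True)
      ultimately show ?thesis
        by (simp only: exp_coeff_nat divide_inverse mult_ac)
    next
      \<comment> \<open>For \<open>k + m < 0\<close> both sides vanish: the left one by the extension by zero, the right one
        because \<open>rGamma\<close> has a zero at \<open>k + m + 1\<close>.\<close>
      case False
      then have "exp_coeff t (int k + m) = 0" "rGamma (real k + real_of_int m + 1) = 0"
        by (simp_all only: exp_coeff_def G if_False)
      then show ?thesis by (simp only: mult_zero_right mult_zero_left div_0)
    qed
  qed
  ultimately show ?thesis
    by (simp add: bessel_I_def summable_sums)
qed

text \<open>
  The first \<open>n\<close> terms of the series of order \<open>- n\<close> are zero; dropping them turns it into the series
  of order \<open>n\<close>.
\<close>

lemma bessel_I_minus:
  assumes "t \<ge> 0"
  shows "bessel_I (- m) (2 * t) = bessel_I m (2 * t)"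
proof -
  have *: "bessel_I (- int n) (2 * t) = bessel_I (int n) (2 * t)" for n
  proof -
    have "(\<Sum>k<n. exp_coeff t (int k) * exp_coeff t (int k + - int n)) = 0"
      by (intro sum.neutral) (auto simp: exp_coeff_def)
    then have "(\<lambda>k. exp_coeff t (int (k + n)) * exp_coeff t (int (k + n) + - int n))
        sums bessel_I (- int n) (2 * t)"
      using bessel_I_sums[OF assms, of "- int n"] by (subst sums_iff_shift) simp
    then have "(\<lambda>k. exp_coeff t (int k) * exp_coeff t (int k + int n)) sums bessel_I (- int n) (2 * t)"
      by (simp add: mult.commute)
    with bessel_I_sums[OF assms, of "int n"] show ?thesis
      by (rule sums_unique2 [symmetric])
  qed
  show ?thesis
  proof (cases "m \<ge> 0")
    case True
    then have "m = int (nat m)" by simp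
    with *[of "nat m"] show ?thesis by metis
  next
    case False
    then have "m = - int (nat (- m))" by simp
    with *[of "nat (- m)"] show ?thesis by (metis minus_minus)
  qed
qed

lemma heat_kernel_sums:
  assumes "t \<ge> 0"
  shows "(\<lambda>k. exp (- 2 * t) * (t ^ k / fact k * (t ^ (k + nat \<bar>m\<bar>) / fact (k + nat \<bar>m\<bar>))))
           sums heat_kernel m t"
proof -
  have "bessel_I m (2 * t) = bessel_I (int (nat \<bar>m\<bar>)) (2 * t)"
    using bessel_I_minus[OF assms, of m] by (cases "m \<ge> 0") simp_all
  then have "heat_kernel m t = exp (- 2 * t) * bessel_I (int (nat \<bar>m\<bar>)) (2 * t)"
    by (simp only: heat_kernel_def)
  moreover have "exp_coeff t (int k) * exp_coeff t (int k + int (nat \<bar>m\<bar>)) =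
      t ^ k / fact k * (t ^ (k + nat \<bar>m\<bar>) / fact (k + nat \<bar>m\<bar>))" for k
    using exp_coeff_nat[of t "k + nat \<bar>m\<bar>"] by (simp only: exp_coeff_nat of_nat_add)
  ultimately show ?thesis
    using sums_mult[OF bessel_I_sums[OF assms, of "int (nat \<bar>m\<bar>)"], of "exp (- 2 * t)"]
    by (simp only:)
qed

lemma heat_kernel_nonneg: "t \<ge> 0 \<Longrightarrow> heat_kernel m t \<ge> 0"
  by (rule sums_le[OF _ sums_zero heat_kernel_sums]) auto

text \<open>
  In the \<open>k\<close>-th term of the series, \<open>(k + \<bar>m\<bar>)!\<close> is replaced by \<open>\<bar>m\<bar>!\<close>; an exponential series in \<open>t\<^sup>2\<close>
  remains.
\<close>

lemma heat_kernel_le: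
  assumes "t \<ge> 0"
  shows "heat_kernel m t \<le> exp (t\<^sup>2) * (t ^ nat \<bar>m\<bar> / fact (nat \<bar>m\<bar>))"
proof -
  define n where "n = nat \<bar>m\<bar>"
  have "exp (- 2 * t) * (t ^ k / fact k * (t ^ (k + n) / fact (k + n)))
      \<le> (t\<^sup>2) ^ k / fact k * (t ^ n / fact n)" for k
  proof -
    have "exp (- 2 * t) * (t ^ k / fact k * (t ^ (k + n) / fact (k + n)))
        \<le> 1 * (t ^ k / fact k * (t ^ (k + n) / fact n))"
      using assms by (intro mult_mono divide_left_mono fact_mono) auto
    then show ?thesis
      by (simp add: power_add power2_eq_square power_mult_distrib mult_ac)
  qed
  moreover have "(\<lambda>k. exp (- 2 * t) * (t ^ k / fact k * (t ^ (k + n) / fact (k + n)))) sums heat_kernel m t"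
    unfolding n_def by (rule heat_kernel_sums[OF assms])
  moreover have "(\<lambda>k. (t\<^sup>2) ^ k / fact k * (t ^ n / fact n)) sums (exp (t\<^sup>2) * (t ^ n / fact n))"
    using exp_coeff_sums[of "t\<^sup>2"] unfolding exp_coeff_nat by (rule sums_mult2)
  ultimately show ?thesis
    unfolding n_def by (rule sums_le)
qed

text \<open>
  For fixed \<open>t\<close> the heat kernel decays superexponentially in \<open>m\<close>. The third power is enough for what
  follows, since the weights of \<open>\<ell>\<^sub>s\<close> grow with exponent \<open>1 + 2 s \<le> 3\<close>.
\<close>

lemma heat_kernel_decay:
  assumes "t \<ge> 0"
  shows "heat_kernel m t * (1 + \<bar>real_of_int m\<bar>) ^ 3 \<le> 6 * exp (t\<^sup>2 + 1 + exp 1 * t)"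
proof -
  define n where "n = nat \<bar>m\<bar>"
  have n: "\<bar>real_of_int m\<bar> = real n"
    by (simp add: n_def)
  \<comment> \<open>From \<open>x\<^sup>3 / 3! \<le> e\<^sup>x\<close> at \<open>x = 1 + n\<close>.\<close>
  have cube: "(1 + real n) ^ 3 \<le> 6 * (exp 1 * exp 1 ^ n)"
    using exp_coeff_le_exp[of "1 + real n" 3] exp_of_nat_mult[of n "1 :: real"]
    by (simp add: exp_coeff_def exp_add fact_numeral)
  have "heat_kernel m t * (1 + real n) ^ 3
      \<le> exp (t\<^sup>2) * (t ^ n / fact n) * (6 * (exp 1 * exp 1 ^ n))"
    using assms cube heat_kernel_le[OF assms, of m] unfolding n_def
    by (intro mult_mono) auto
  \<comment> \<open>The factor \<open>e\<^sup>n\<close> is absorbed by rescaling: \<open>e\<^sup>n t\<^sup>n / n!\<close> is a term of the series of \<open>exp (e t)\<close>.\<close>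
  also have "\<dots> = 6 * exp (t\<^sup>2 + 1) * exp_coeff (exp 1 * t) (int n)"
    by (simp add: exp_coeff_nat power_mult_distrib exp_add mult_ac)
  also have "\<dots> \<le> 6 * exp (t\<^sup>2 + 1) * exp (exp 1 * t)"
    using assms by (intro mult_left_mono exp_coeff_le_exp) auto
  finally show ?thesis
    by (simp add: n exp_add mult_ac)
qed

text \<open>
  The double family \<open>exp_coeff t k * exp_coeff t (k + m)\<close> is summed in two ways. Over \<open>m\<close> first, it
  gives \<open>exp t * exp t\<close>, since \<open>m \<mapsto> k + m\<close> permutes the integers; over \<open>k\<close> first, it gives the
  Bessel functions \<open>I\<^sub>m(2t)\<close>.
\<close>

lemma heat_kernel_has_sum:
  assumes "t \<ge> 0"
  shows "((\<lambda>m. heat_kernel m t) has_sum 1) UNIV"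
proof -
  define f where "f = (\<lambda>(k, m). exp_coeff t (int k) * exp_coeff t (int k + m))"
  have rows: "((\<lambda>m. f (k, m)) has_sum (exp_coeff t (int k) * exp t)) UNIV" for k
  proof -
    have "((\<lambda>m. exp_coeff t (int k + m)) has_sum exp t) UNIV"
      using exp_coeff_has_sum[OF assms]
      by (subst has_sum_reindex_bij_witness[of _ "\<lambda>a. a - int k" "\<lambda>m. int k + m" UNIV "exp_coeff t"]) auto
    then show ?thesis by (simp add: f_def has_sum_cmult_right)
  qed
  have total: "((\<lambda>k. exp_coeff t (int k) * exp t) has_sum (exp t * exp t)) UNIV"
    using assms exp_coeff_sums
    by (intro sums_nonneg_imp_has_sum sums_mult2) (auto simp: exp_coeff_nonneg)
  have "(f has_sum (exp t * exp t)) (UNIV \<times> UNIV)"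
  proof (rule has_sum_SigmaI[OF rows total])
    show "f summable_on UNIV \<times> UNIV"
      using rows total assms
      by (intro summable_on_SigmaI[where g = "\<lambda>k. exp_coeff t (int k) * exp t"])
        (auto simp: f_def exp_coeff_nonneg has_sum_imp_summable)
  qed
  then have "((\<lambda>(m, k). f (k, m)) has_sum (exp t * exp t)) (UNIV \<times> UNIV)"
    by (subst has_sum_swap) (simp add: case_prod_unfold)
  moreover have "((\<lambda>k. f (k, m)) has_sum bessel_I m (2 * t)) UNIV" for m
    using assms bessel_I_sums[of t m] unfolding f_def
    by (intro sums_nonneg_imp_has_sum) (auto simp: exp_coeff_nonneg)
  ultimately have "((\<lambda>m. bessel_I m (2 * t)) has_sum (exp t * exp t)) UNIV"
    by (intro has_sum_SigmaD[where f = "\<lambda>(m, k). f (k, m)" and B = "\<lambda>_. UNIV"]) auto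
  then have "((\<lambda>m. exp (- 2 * t) * bessel_I m (2 * t)) has_sum (exp (- 2 * t) * (exp t * exp t))) UNIV"
    by (rule has_sum_cmult_right)
  then show ?thesis
    by (simp add: heat_kernel_def flip: exp_add)
qed

section \<open>The Mellin transform of the heat kernel\<close>

lemma Gamma_conv_nn_integral_scaled:
  fixes p r :: real
  assumes "p > 0" "r > 0"
  shows "(\<integral>\<^sup>+t. ennreal (indicator {0<..} t * (t powr (p - 1) * exp (- r * t))) \<partial>lborel)
           = ennreal (Gamma p / r powr p)"
proof -
  have "(\<integral>\<^sup>+t. ennreal (indicator {0<..} t * (t powr (p - 1) * exp (- r * t))) \<partial>lborel) =
      ennreal \<bar>1 / r\<bar> * (\<integral>\<^sup>+t. ennreal (indicator {0<..} (0 + 1 / r * t) *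
        ((0 + 1 / r * t) powr (p - 1) * exp (- r * (0 + 1 / r * t)))) \<partial>lborel)"
    using assms by (intro nn_integral_real_affine) auto
  also have "(\<integral>\<^sup>+t. ennreal (indicator {0<..} (0 + 1 / r * t) *
        ((0 + 1 / r * t) powr (p - 1) * exp (- r * (0 + 1 / r * t)))) \<partial>lborel) =
      (\<integral>\<^sup>+t. ennreal (r powr (1 - p) * (indicator {0..} t * t powr (p - 1) / exp t)) \<partial>lborel)"
  proof (intro nn_integral_cong arg_cong[where f = ennreal])
    fix t :: real
    have arg: "0 + 1 / r * t = t / r" "- r * (t / r) = - t"
      using assms by simp_all
    have "(t / r) powr (p - 1) = r powr (1 - p) * t powr (p - 1)" if "t > 0"
      using assms that powr_minus_divide[of r "p - 1"] by (simp add: powr_divide)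
    then show "indicator {0<..} (0 + 1 / r * t) *
        ((0 + 1 / r * t) powr (p - 1) * exp (- r * (0 + 1 / r * t))) =
        r powr (1 - p) * (indicator {0..} t * t powr (p - 1) / exp t)"
      unfolding arg using assms
      by (cases "t > 0") (auto simp: indicator_def exp_minus zero_less_divide_iff divide_simps)
  qed
  also have "\<dots> = ennreal (r powr (1 - p)) * ennreal (Gamma p)"
    using assms Gamma_conv_nn_integral_real[of p] by (subst nn_integral_cmult_ennreal) auto
  also have "ennreal \<bar>1 / r\<bar> * \<dots> = ennreal (1 / r * (r powr (1 - p) * Gamma p))"
    using assms by (subst ennreal_mult', simp, subst ennreal_mult', simp, simp)
  also have "1 / r * (r powr (1 - p) * Gamma p) = Gamma p / r powr p"
    using assms by (simp add: powr_diff)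
  finally show ?thesis .
qed

text \<open>
  Termwise integration of the Bessel series produces \<open>\<Gamma>(z) / 2\<^sup>z\<close> with \<open>z = 2 k + n - s\<close>, where
  \<open>n = \<bar>m\<bar>\<close>. The duplication formula splits this into \<open>\<Gamma>(k + a) \<Gamma>(k + b)\<close> with \<open>a = (n - s) / 2\<close> and
  \<open>b = (n - s + 1) / 2\<close>, so the sum over \<open>k\<close> is a Gauss series with third parameter \<open>n + 1\<close>. It
  converges because \<open>n + 1 - a - b = 1/2 + s > 0\<close>. A second use of the duplication formula, on \<open>\<Gamma>(a) \<Gamma>(b)\<close> and on
  \<open>\<Gamma>(n + 1 - a) \<Gamma>(n + 1 - b)\<close>, gives the closed form of the kernel. The dilation \<open>c\<close> accounts for
  the mesh size: \<open>c = 1 / h\<^sup>2\<close> yields the factor \<open>h\<^sup>-\<^sup>2\<^sup>s\<close>.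
\<close>

lemma heat_kernel_Mellin:
  fixes c s :: real
  assumes "0 < s" "s < 1" "c > 0" "m \<noteq> 0"
  shows "(\<integral>\<^sup>+t. ennreal (indicator {0<..} t * (heat_kernel m (c * t) / t powr (1 + s))) \<partial>lborel)
           = ennreal (c powr s * (\<bar>Gamma (- s)\<bar> * discrete_kernel s m))"
proof -
  define n where "n = nat \<bar>m\<bar>"
  define a b where "a = (real n - s) / 2" and "b = (real n - s + 1) / 2"
  define p where "p = (\<lambda>k t. indicator {0<..} t *
     (exp (- 2 * (c * t)) * ((c * t) ^ k / fact k * ((c * t) ^ (k + n) / fact (k + n))) / t powr (1 + s)))"
  have n: "n \<ge> 1" "\<bar>real_of_int m\<bar> = real n"
    using assms by (auto simp: n_def)
  have ab: "a > 0" "b > 0" "real n + 1 > a + b" "real n + 1 - a - b = 1 / 2 + s"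
    using n assms by (auto simp: a_def b_def field_simps)
  have p_nonneg: "p k t \<ge> 0" for k t
    using assms by (auto simp: p_def indicator_def)
  have "(\<integral>\<^sup>+t. ennreal (indicator {0<..} t * (heat_kernel m (c * t) / t powr (1 + s))) \<partial>lborel) =
      (\<integral>\<^sup>+t. (\<Sum>k. ennreal (p k t)) \<partial>lborel)"
  proof (intro nn_integral_cong)
    fix t :: real
    have "(\<lambda>k. p k t) sums (indicator {0<..} t * (heat_kernel m (c * t) / t powr (1 + s)))"
    proof (cases "t > 0")
      case True
      then show ?thesis
        unfolding p_def n_def using assms
        by (intro sums_mult sums_divide heat_kernel_sums) auto
    qed (simp add: p_def)
    then show "ennreal (indicator {0<..} t * (heat_kernel m (c * t) / t powr (1 + s))) = (\<Sum>k. ennreal (p k t))"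
      by (rule suminf_ennreal_eq[OF p_nonneg, symmetric])
  qed
  also have "\<dots> = (\<Sum>k. \<integral>\<^sup>+t. ennreal (p k t) \<partial>lborel)"
    by (rule nn_integral_suminf) (simp add: p_def)
  also have "\<dots> = (\<Sum>k. ennreal (c powr s / (2 * sqrt pi) *
      (Gamma (real k + a) * Gamma (real k + b) / (fact k * Gamma (real k + (real n + 1))))))"
  proof (intro suminf_cong)
    fix k
    define z where "z = 2 * real k + real n - s"
    have z: "z > 0" using n assms by (simp add: z_def)
    have "p k t = c ^ (2 * k + n) / (fact k * fact (k + n)) *
        (indicator {0<..} t * (t powr (z - 1) * exp (- (2 * c) * t)))" for t
    proof (cases "t > 0")
      case True
      have "t powr (z - 1) = t powr (real (2 * k + n) - (1 + s))"
        by (simp add: z_def algebra_simps)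
      also have "\<dots> = t ^ (2 * k + n) / t powr (1 + s)"
        using True by (simp only: powr_diff powr_realpow)
      finally have "t powr (z - 1) = t ^ (2 * k + n) / t powr (1 + s)" .
      moreover have "(c * t) ^ k * (c * t) ^ (k + n) = c ^ (2 * k + n) * t ^ (2 * k + n)"
        by (simp only: power_mult_distrib [symmetric] power_add [symmetric]) (simp add: mult_2 add.assoc)
      ultimately show ?thesis
        using True by (simp add: p_def)
    qed (simp add: p_def)
    then have "(\<integral>\<^sup>+t. ennreal (p k t) \<partial>lborel) = ennreal (c ^ (2 * k + n) / (fact k * fact (k + n))) *
        (\<integral>\<^sup>+t. ennreal (indicator {0<..} t * (t powr (z - 1) * exp (- (2 * c) * t))) \<partial>lborel)"
      using assms by (simp only:) (rule nn_integral_cmult_ennreal; simp)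
    also have "\<dots> = ennreal (c ^ (2 * k + n) / (fact k * fact (k + n))) * ennreal (Gamma z / (2 * c) powr z)"
      using assms z by (subst Gamma_conv_nn_integral_scaled) auto
    also have "\<dots> = ennreal (c ^ (2 * k + n) / (fact k * fact (k + n)) * (Gamma z / (2 * c) powr z))"
      using assms by (subst ennreal_mult') auto
    also have "c ^ (2 * k + n) / (fact k * fact (k + n)) * (Gamma z / (2 * c) powr z) =
        c powr s / (2 * sqrt pi) *
        (Gamma (real k + a) * Gamma (real k + b) / (fact k * Gamma (real k + (real n + 1))))"
    proof -
      have "Gamma (real k + a) * Gamma (real k + b) = 2 powr (1 - z) * sqrt pi * Gamma z"
        using Gamma_legendre_duplication_real[OF z]
        by (simp add: a_def b_def z_def add_divide_distrib diff_divide_distrib algebra_simps)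
      moreover have "Gamma (real k + (real n + 1)) = fact (k + n)"
        using Gamma_fact[of "k + n", where ?'a = real] by (simp add: add_ac)
      moreover have "c powr s * c powr z = c ^ (2 * k + n)"
        using assms powr_realpow[of c "2 * k + n"] by (simp add: z_def flip: powr_add)
      ultimately show ?thesis
        using assms by (simp add: powr_mult powr_diff field_simps)
    qed
    finally show "(\<integral>\<^sup>+t. ennreal (p k t) \<partial>lborel) = ennreal (c powr s / (2 * sqrt pi) *
      (Gamma (real k + a) * Gamma (real k + b) / (fact k * Gamma (real k + (real n + 1)))))" .
  qed
  also have "\<dots> = ennreal (c powr s / (2 * sqrt pi) *
      (Gamma a * Gamma b * Gamma (real n + 1 - a - b) / (Gamma (real n + 1 - a) * Gamma (real n + 1 - b))))"
    using ab by (intro suminf_ennreal_eq sums_mult Gauss_hypergeometric_sum)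
      (auto intro!: mult_nonneg_nonneg divide_nonneg_nonneg Gamma_real_nonneg)
  also have "c powr s / (2 * sqrt pi) *
      (Gamma a * Gamma b * Gamma (real n + 1 - a - b) / (Gamma (real n + 1 - a) * Gamma (real n + 1 - b))) =
      c powr s * (\<bar>Gamma (- s)\<bar> * discrete_kernel s m)"
  proof -
    have num: "Gamma a * Gamma b = 2 powr (1 - (real n - s)) * sqrt pi * Gamma (real n - s)"
      using n assms unfolding a_def b_def by (intro Gamma_legendre_duplication_real) auto
    have halves: "(real n + 1 + s) / 2 = real n + 1 - b" "(real n + 1 + s + 1) / 2 = real n + 1 - a"
      by (simp_all add: a_def b_def field_simps)
    have "real n + 1 + s > 0"
      using assms by simp
    from Gamma_legendre_duplication_real[OF this]
    have den: "Gamma (real n + 1 - a) * Gamma (real n + 1 - b) =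
        2 powr (1 - (real n + 1 + s)) * sqrt pi * Gamma (real n + 1 + s)"
      unfolding halves by (simp only: mult.commute)
    have pow: "2 powr (1 - (real n - s)) = 2 * 4 powr s * 2 powr (1 - (real n + 1 + s))"
    proof -
      have "(4::real) powr s = 2 powr (2 * s)"
        using powr_powr[of 2 2 s] by simp
      then have "2 * 4 powr s * 2 powr (1 - (real n + 1 + s)) = 2 powr (1 + 2 * s + (1 - (real n + 1 + s)))"
        unfolding powr_add by simp
      then show ?thesis by (simp add: algebra_simps)
    qed
    have nz: "Gamma (- s) \<noteq> 0"
      using Gamma_minus_neg[OF assms(1,2)] by simp
    show ?thesis
      unfolding num den ab pow discrete_kernel_def n(2) using nz by (simp add: field_simps)
  qed
  finally show ?thesis .
qed

lemma measurable_heat_kernel: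
  fixes c s :: real
  assumes "c > 0"
  shows "(\<lambda>t. indicator {0<..} t * (heat_kernel m (c * t) / t powr (1 + s))) \<in> borel_measurable borel"
proof -
  have "indicator {0<..} t * (heat_kernel m (c * t) / t powr (1 + s)) =
      indicator {0<..} t * ((\<Sum>k. exp (- 2 * (c * t)) *
        ((c * t) ^ k / fact k * ((c * t) ^ (k + nat \<bar>m\<bar>) / fact (k + nat \<bar>m\<bar>)))) / t powr (1 + s))" for t
  proof (cases "t > 0")
    case True
    then show ?thesis
      using assms heat_kernel_sums[of "c * t" m, THEN sums_unique] by simp
  qed simp
  then show ?thesis by (simp only:) simp
qed

lemma heat_kernel_Mellin_integral:
  fixes c s :: real
  assumes "0 < s" "s < 1" "c > 0" "m \<noteq> 0"
  shows "has_bochner_integral lborel (\<lambda>t. indicator {0<..} t * (heat_kernel m (c * t) / t powr (1 + s)))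
           (c powr s * (\<bar>Gamma (- s)\<bar> * discrete_kernel s m))"
proof (rule has_bochner_integral_nn_integral)
  show "c powr s * (\<bar>Gamma (- s)\<bar> * discrete_kernel s m) \<ge> 0"
    using assms by (simp add: discrete_kernel_nonneg)
qed (use assms measurable_heat_kernel heat_kernel_Mellin in \<open>auto simp: indicator_def heat_kernel_nonneg\<close>)

section \<open>Summability in the weighted spaces\<close>

lemma summable_on_int_powr:
  assumes "p > 1"
  shows "(\<lambda>m::int. 1 / (1 + \<bar>real_of_int m\<bar>) powr p) summable_on UNIV"
proof -
  have "summable (\<lambda>n. real n powr (- p))"
    using assms by (simp add: summable_real_powr_iff)
  then have "summable (\<lambda>n. real (n + 2) powr (- p))"
    by (subst summable_iff_shift)
  then have "summable (\<lambda>n. 1 / (1 + \<bar>real_of_int (int n + 1)\<bar>) powr p)"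
    by (simp add: powr_minus_divide add.commute)
  then have "(\<lambda>n. 1 / (1 + \<bar>real_of_int (int n + 1)\<bar>) powr p) summable_on UNIV"
    by (intro summable_nonneg_imp_summable_on) auto
  then have "(\<lambda>m::int. 1 / (1 + \<bar>real_of_int m\<bar>) powr p) summable_on (UNIV - {0})"
    using has_sum_even_int[of "\<lambda>m::int. 1 / (1 + \<bar>real_of_int m\<bar>) powr p"]
    by (auto simp: summable_on_def)
  then have "(\<lambda>m::int. 1 / (1 + \<bar>real_of_int m\<bar>) powr p) summable_on insert 0 (UNIV - {0})"
    by (subst summable_on_insert_iff)
  then show ?thesis by (simp add: insert_UNIV)
qed

text \<open>
  Membership in \<open>\<ell>\<^sub>s\<close> is invariant under translation: \<open>1 + \<bar>m\<bar> \<le> (1 + \<bar>j - m\<bar>) (1 + \<bar>j\<bar>)\<close>, so decay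
  measured from \<open>j\<close> is as good as decay measured from the origin.
\<close>

lemma ell_mult_abs_summable:
  assumes u: "u \<in> ell s" and s: "s \<ge> 0"
    and g: "\<And>m. \<bar>g m\<bar> * (1 + \<bar>real_of_int (j - m)\<bar>) powr (1 + 2 * s) \<le> C"
  shows "(\<lambda>m. \<bar>g m * u m\<bar>) summable_on UNIV"
proof -
  define w where "w = (\<lambda>m. (1 + \<bar>real_of_int m\<bar>) powr (1 + 2 * s))"
  have w_pos: "w m > 0" for m by (simp add: w_def add_pos_nonneg)
  have C: "C \<ge> 0"
    using order_trans[OF abs_ge_zero g[of j, simplified]] .
  have bound: "\<bar>g m\<bar> \<le> C * w j / w m" for m
  proof -
    have "1 + \<bar>real_of_int m\<bar> \<le> (1 + \<bar>real_of_int (j - m)\<bar>) * (1 + \<bar>real_of_int j\<bar>)"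
    proof -
      have "1 + \<bar>real_of_int m\<bar> \<le> 1 + \<bar>real_of_int (j - m)\<bar> + \<bar>real_of_int j\<bar>"
        by simp
      also have "\<dots> \<le> (1 + \<bar>real_of_int (j - m)\<bar>) * (1 + \<bar>real_of_int j\<bar>)"
        by (simp add: algebra_simps)
      finally show ?thesis .
    qed
    then have "w m \<le> ((1 + \<bar>real_of_int (j - m)\<bar>) * (1 + \<bar>real_of_int j\<bar>)) powr (1 + 2 * s)"
      unfolding w_def using s by (intro powr_mono2) auto
    also have "\<dots> = w (j - m) * w j"
      unfolding w_def by (simp add: powr_mult)
    finally have "\<bar>g m\<bar> * w m \<le> \<bar>g m\<bar> * (w (j - m) * w j)"
      by (intro mult_left_mono) auto
    also have "\<dots> \<le> C * w j"
      using mult_right_mono[OF g[of m], of "w j"] w_pos[of j] by (simp add: w_def mult.assoc)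
    finally show ?thesis
      using w_pos[of m] by (simp add: pos_le_divide_eq)
  qed
  have "(\<lambda>m. C * w j * (\<bar>u m\<bar> / w m)) summable_on UNIV"
    using u unfolding ell_def w_def by (intro summable_on_cmult_right) auto
  then show ?thesis
  proof (rule summable_on_comparison_test)
    fix m
    show "\<bar>g m * u m\<bar> \<le> C * w j * (\<bar>u m\<bar> / w m)"
      using mult_right_mono[OF bound[of m], of "\<bar>u m\<bar>"] by (simp add: abs_mult)
  qed auto
qed

lemma bounded_mem_ell:
  assumes "u \<in> ell_infinity" "s > 0"
  shows "u \<in> ell s"
proof -
  from assms(1) obtain B where B: "\<And>m. \<bar>u m\<bar> \<le> B"
    by (auto simp: ell_infinity_def bounded_iff)
  have "(\<lambda>m::int. B * (1 / (1 + \<bar>real_of_int m\<bar>) powr (1 + 2 * s))) summable_on UNIV"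
    using assms(2) by (intro summable_on_cmult_right summable_on_int_powr) auto
  then have "(\<lambda>m. \<bar>u m\<bar> / (1 + \<bar>real_of_int m\<bar>) powr (1 + 2 * s)) summable_on UNIV"
    by (rule summable_on_comparison_test) (auto simp: B divide_right_mono)
  then show ?thesis by (simp add: ell_def)
qed

lemma ell_mono:
  assumes "u \<in> ell r" "r \<le> s"
  shows "u \<in> ell s"
proof -
  have "(\<lambda>m. \<bar>u m\<bar> / (1 + \<bar>real_of_int m\<bar>) powr (1 + 2 * s)) summable_on UNIV"
    using assms(1) unfolding ell_def mem_Collect_eq
    by (rule summable_on_comparison_test) (use assms(2) in \<open>auto intro!: divide_left_mono powr_mono mult_pos_pos simp: add_pos_nonneg\<close>)
  then show ?thesis by (simp add: ell_def)
qed

lemma heat_kernel_mult_summable: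
  assumes "u \<in> ell s" "0 \<le> s" "s \<le> 1" "t \<ge> 0"
  shows "(\<lambda>m. heat_kernel (j - m) t * u m) summable_on UNIV"
proof -
  have "\<bar>heat_kernel (j - m) t\<bar> * (1 + \<bar>real_of_int (j - m)\<bar>) powr (1 + 2 * s)
      \<le> 6 * exp (t\<^sup>2 + 1 + exp 1 * t)" for m
  proof -
    have "(1 + \<bar>real_of_int (j - m)\<bar>) powr (1 + 2 * s) \<le> (1 + \<bar>real_of_int (j - m)\<bar>) powr 3"
      using assms by (intro powr_mono) auto
    also have "\<dots> = (1 + \<bar>real_of_int (j - m)\<bar>) ^ 3"
      by (simp add: add_pos_nonneg)
    finally have "heat_kernel (j - m) t * (1 + \<bar>real_of_int (j - m)\<bar>) powr (1 + 2 * s)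
        \<le> heat_kernel (j - m) t * (1 + \<bar>real_of_int (j - m)\<bar>) ^ 3"
      using assms by (intro mult_left_mono heat_kernel_nonneg)
    also have "\<dots> \<le> 6 * exp (t\<^sup>2 + 1 + exp 1 * t)"
      by (rule heat_kernel_decay[OF assms(4)])
    finally show ?thesis
      using assms by (simp add: heat_kernel_nonneg)
  qed
  from ell_mult_abs_summable[OF assms(1,2) this] show ?thesis
    by (subst summable_on_iff_abs_summable_on_real) simp
qed

text \<open>
  Only the values of the kernel off the origin occur; the value at \<open>0\<close> is set to \<open>0\<close> so that the criterion
  \<open>ell_mult_abs_summable\<close> applies on all of the integers.
\<close>

lemma discrete_kernel_mult_abs_summable:
  assumes "u \<in> ell s" "0 < s" "s < 1"
  shows "(\<lambda>m. \<bar>u m * discrete_kernel s (j - m)\<bar>) summable_on (UNIV - {j})"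
proof -
  define g where "g = (\<lambda>m. if m = j then 0 else discrete_kernel s (j - m))"
  define C where "C = kernel_constant s * (1 - s) powr (- (1 + 2 * s))"
  have C: "C \<ge> 0"
    using assms kernel_constant_pos[of s] by (simp add: C_def)
  have "\<bar>g m\<bar> * (1 + \<bar>real_of_int (j - m)\<bar>) powr (1 + 2 * s) \<le> C * 2 powr (1 + 2 * s)" for m
  proof (cases "m = j")
    case False
    define x where "x = \<bar>real_of_int (j - m)\<bar>"
    have x: "x \<ge> 1"
      unfolding x_def using False by (intro abs_int_ge_1) auto
    have "g m \<ge> 0" "g m \<le> C / x powr (1 + 2 * s)"
      using False assms discrete_kernel_decay[of s "j - m"] discrete_kernel_nonneg[of s "j - m"]
      by (simp_all add: g_def C_def x_def)
    moreover have "(1 + x) powr (1 + 2 * s) \<le> (2 * x) powr (1 + 2 * s)"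
      using x assms by (intro powr_mono2) auto
    ultimately have "g m * (1 + x) powr (1 + 2 * s) \<le> C / x powr (1 + 2 * s) * (2 * x) powr (1 + 2 * s)"
      using C by (intro mult_mono) auto
    also have "\<dots> = C * 2 powr (1 + 2 * s)"
      using x by (simp add: powr_mult)
    finally show ?thesis
      using \<open>g m \<ge> 0\<close> by (simp add: x_def)
  qed (simp add: g_def C)
  then have "(\<lambda>m. \<bar>g m * u m\<bar>) summable_on UNIV"
    using assms by (intro ell_mult_abs_summable[of u s g j]) auto
  then have "(\<lambda>m. \<bar>g m * u m\<bar>) summable_on (UNIV - {j})"
    by (rule summable_on_subset_banach) auto
  then show ?thesis
    by (rule summable_on_cong[THEN iffD1, rotated]) (simp add: g_def mult.commute)
qed

lemma kernel_differences_summable: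
  assumes "u \<in> ell s" "0 < s" "s < 1"
  shows "(\<lambda>m. \<bar>(u j - u m) * discrete_kernel s (j - m)\<bar>) summable_on (UNIV - {j})"
proof -
  have "(\<lambda>_. u j) \<in> ell s"
    using assms by (intro bounded_mem_ell) (auto simp: ell_infinity_def)
  then have "(\<lambda>m. \<bar>u j * discrete_kernel s (j - m)\<bar> + \<bar>u m * discrete_kernel s (j - m)\<bar>)
      summable_on (UNIV - {j})"
    using assms by (intro summable_on_add discrete_kernel_mult_abs_summable) auto
  then show ?thesis
    by (rule summable_on_comparison_test) (auto simp: left_diff_distrib)
qed

lemma kernel_term_summable:
  assumes "u \<in> ell s" "0 < s" "s < 1"
  shows "(\<lambda>m. (u j - u m) * discrete_kernel s (j - m)) summable_on (UNIV - {j})"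
  using kernel_differences_summable[OF assms, of j]
  by (subst summable_on_iff_abs_summable_on_real) simp

section \<open>The pointwise formula\<close>

text \<open>
  The heat kernel has total mass \<open>1\<close>, so \<open>u j\<close> is itself an average of the constant \<open>u j\<close>.
\<close>

lemma heat_semigroup_diff_has_sum:
  assumes "u \<in> ell s" "0 \<le> s" "s \<le> 1" "t \<ge> 0"
  shows "((\<lambda>m. heat_kernel (j - m) (t / h\<^sup>2) * (u m - u j)) has_sum (heat_semigroup h t u j - u j)) UNIV"
proof -
  have t: "t / h\<^sup>2 \<ge> 0" using assms by simp
  have "((\<lambda>m. heat_kernel (j - m) (t / h\<^sup>2)) has_sum 1) UNIV"
    using heat_kernel_has_sum[OF t]
    by (subst has_sum_reindex_bij_witness[of _ "\<lambda>m. j - m" "\<lambda>m. j - m" UNIV "\<lambda>m. heat_kernel m (t / h\<^sup>2)"]) auto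
  then have "((\<lambda>m. heat_kernel (j - m) (t / h\<^sup>2) * (- u j)) has_sum (1 * (- u j))) UNIV"
    by (rule has_sum_cmult_left)
  moreover have "((\<lambda>m. heat_kernel (j - m) (t / h\<^sup>2) * u m) has_sum heat_semigroup h t u j) UNIV"
    unfolding heat_semigroup_def using heat_kernel_mult_summable[OF assms(1-3) t]
    by (rule has_sum_infsum)
  ultimately have "((\<lambda>m. heat_kernel (j - m) (t / h\<^sup>2) * u m + heat_kernel (j - m) (t / h\<^sup>2) * (- u j))
      has_sum (heat_semigroup h t u j + 1 * (- u j))) UNIV"
    by (intro has_sum_add)
  then show ?thesis by (simp add: algebra_simps)
qed

lemma count_space_integral_eq_has_sum:
  fixes f :: "'a \<Rightarrow> real"
  assumes "(f has_sum S) UNIV"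
  shows "integral\<^sup>L (count_space UNIV) f = S"
proof -
  have "Infinite_Set_Sum.abs_summable_on f UNIV"
    using assms summable_on_iff_abs_summable_on_real[of f UNIV]
    by (auto simp: has_sum_iff simp flip: abs_summable_equivalent)
  then have "infsetsum f UNIV = infsum f UNIV"
    by (rule infsetsum_infsum)
  with assms show ?thesis
    by (simp add: infsetsum_def has_sum_iff)
qed

text \<open>
  Fubini's theorem for the counting measure on the integers and Lebesgue measure in \<open>t\<close>. The integral
  of \<open>\<bar>f m\<bar>\<close> over \<open>t\<close> is a constant times \<open>\<bar>u m - u j\<bar> K\<^sub>s(j - m)\<close> by \<open>heat_kernel_Mellin\<close>, and this is
  summable in \<open>m\<close> because both \<open>u\<close> and the constant \<open>u j\<close> belong to \<open>\<ell>\<^sub>s\<close>. The term \<open>m = j\<close>, whose Mellin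
  integral diverges, carries the factor \<open>u m - u j = 0\<close>. The sign in the result is that of
  \<open>\<Gamma>(- s) < 0\<close>.
\<close>

lemma fractional_laplacian_pointwise:
  fixes h s :: real
  assumes u: "u \<in> ell s" and s: "0 < s" "s < 1" and h: "h > 0"
  shows "set_integrable lborel {0<..} (\<lambda>t. (heat_semigroup h t u j - u j) / t powr (1 + s))" (is ?int)
    and "fractional_laplacian h s u j =
          1 / h powr (2 * s) * (\<Sum>\<^sub>\<infinity>m\<in>UNIV - {j}. (u j - u m) * discrete_kernel s (j - m))" (is ?eq)
proof -
  interpret pair_sigma_finite "count_space (UNIV :: int set)" lborel
    by (intro pair_sigma_finite.intro sigma_finite_measure_count_space lborel.sigma_finite_measure_axioms)
  define c where "c = 1 / h\<^sup>2"
  have c: "c > 0" using h by (simp add: c_def)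
  define w where "w = c powr s * \<bar>Gamma (- s)\<bar>"
  define f where "f = (\<lambda>m t. indicator {0<..} t * (heat_kernel (j - m) (c * t) / t powr (1 + s)) * (u m - u j))"
  define a where "a = (\<lambda>m. w * (discrete_kernel s (j - m) * (u m - u j)))"
  have int_f: "has_bochner_integral lborel (f m) (a m)" for m
  proof (cases "m = j")
    case False
    then show ?thesis
      unfolding f_def a_def w_def mult.assoc [symmetric] using s c
      by (intro has_bochner_integral_mult_left heat_kernel_Mellin_integral[unfolded mult.assoc [symmetric]]) auto
  qed (simp add: f_def a_def has_bochner_integral_zero)
  have int_norm_f: "(\<integral>t. norm (f m t) \<partial>lborel) = \<bar>a m\<bar>" for m
  proof (cases "m = j")
    case False
    have "norm (f m t) = indicator {0<..} t * (heat_kernel (j - m) (c * t) / t powr (1 + s)) * \<bar>u m - u j\<bar>" for t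
      using c by (auto simp: f_def indicator_def abs_mult heat_kernel_nonneg)
    moreover have "has_bochner_integral lborel
       (\<lambda>t. indicator {0<..} t * (heat_kernel (j - m) (c * t) / t powr (1 + s)) * \<bar>u m - u j\<bar>)
       (c powr s * (\<bar>Gamma (- s)\<bar> * discrete_kernel s (j - m)) * \<bar>u m - u j\<bar>)"
      using s c False by (intro has_bochner_integral_mult_left heat_kernel_Mellin_integral) auto
    moreover have "discrete_kernel s (j - m) \<ge> 0"
      using s False by (intro discrete_kernel_nonneg) auto
    ultimately show ?thesis
      by (simp add: has_bochner_integral_integral_eq a_def w_def abs_mult)
  qed (simp add: f_def a_def)
  have sum_a: "(a has_sum (- w * (\<Sum>\<^sub>\<infinity>m\<in>UNIV - {j}. (u j - u m) * discrete_kernel s (j - m)))) UNIV"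
  proof -
    have "((\<lambda>m. (u j - u m) * discrete_kernel s (j - m)) has_sum
        (\<Sum>\<^sub>\<infinity>m\<in>UNIV - {j}. (u j - u m) * discrete_kernel s (j - m))) (UNIV - {j})"
      using kernel_differences_summable[OF u s, of j]
      by (intro has_sum_infsum) (subst summable_on_iff_abs_summable_on_real, simp)
    then have "((\<lambda>m. - w * ((u j - u m) * discrete_kernel s (j - m))) has_sum
        (- w * (\<Sum>\<^sub>\<infinity>m\<in>UNIV - {j}. (u j - u m) * discrete_kernel s (j - m)))) (UNIV - {j})"
      by (rule has_sum_cmult_right)
    then show ?thesis
      by (subst has_sum_cong_neutral[where T = "UNIV - {j}" and g = "\<lambda>m. - w * ((u j - u m) * discrete_kernel s (j - m))"])
        (auto simp: a_def algebra_simps)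
  qed
  have int_pair: "integrable (count_space UNIV \<Otimes>\<^sub>M lborel) (\<lambda>(m, t). f m t)"
  proof (rule Fubini_integrable)
    show "(\<lambda>(m, t). f m t) \<in> borel_measurable (count_space UNIV \<Otimes>\<^sub>M lborel)"
    proof (rule measurable_pair_measure_countable1)
      show "(\<lambda>t. case (m, t) of (m, t) \<Rightarrow> f m t) \<in> borel_measurable lborel" for m
        using borel_measurable_has_bochner_integral[OF int_f[of m]] by simp
    qed simp
    have "Infinite_Set_Sum.abs_summable_on a UNIV"
      using sum_a summable_on_iff_abs_summable_on_real[of a UNIV]
      by (auto simp: has_sum_iff simp flip: abs_summable_equivalent)
    then show "integrable (count_space UNIV) (\<lambda>m. \<integral>t. norm (case (m, t) of (m, t) \<Rightarrow> f m t) \<partial>lborel)"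
      by (simp add: int_norm_f[unfolded real_norm_def] Infinite_Set_Sum.abs_summable_on_def)
    show "AE m in count_space UNIV. integrable lborel (\<lambda>t. case (m, t) of (m, t) \<Rightarrow> f m t)"
      using int_f by (simp add: has_bochner_integral_iff)
  qed
  have slice: "(\<integral>m. f m t \<partial>count_space UNIV) =
      indicator {0<..} t *\<^sub>R ((heat_semigroup h t u j - u j) / t powr (1 + s))" for t
  proof (cases "t > 0")
    case True
    have "((\<lambda>m. heat_kernel (j - m) (t / h\<^sup>2) * (u m - u j) * (1 / t powr (1 + s))) has_sum
        (heat_semigroup h t u j - u j) * (1 / t powr (1 + s))) UNIV"
      using u s True by (intro has_sum_cmult_left heat_semigroup_diff_has_sum[of u s]) auto
    then have "((\<lambda>m. f m t) has_sum ((heat_semigroup h t u j - u j) / t powr (1 + s))) UNIV"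
      using True by (simp add: f_def c_def)
    from count_space_integral_eq_has_sum[OF this] show ?thesis
      using True by simp
  qed (simp add: f_def)
  show ?int
    using integrable_snd[OF int_pair] unfolding set_integrable_def slice .
  have "(LINT t:{0<..}|lborel. (heat_semigroup h t u j - u j) / t powr (1 + s)) =
      (\<integral>t. (\<integral>m. f m t \<partial>count_space UNIV) \<partial>lborel)"
    unfolding set_lebesgue_integral_def slice ..
  also have "\<dots> = (\<integral>m. (\<integral>t. f m t \<partial>lborel) \<partial>count_space UNIV)"
    by (rule Fubini_integral[OF int_pair])
  also have "\<dots> = (\<integral>m. a m \<partial>count_space UNIV)"
    by (simp only: has_bochner_integral_integral_eq[OF int_f])
  also have "\<dots> = - w * (\<Sum>\<^sub>\<infinity>m\<in>UNIV - {j}. (u j - u m) * discrete_kernel s (j - m))"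
    by (rule count_space_integral_eq_has_sum[OF sum_a])
  finally have "fractional_laplacian h s u j =
      1 / Gamma (- s) * (- w * (\<Sum>\<^sub>\<infinity>m\<in>UNIV - {j}. (u j - u m) * discrete_kernel s (j - m)))"
    by (simp only: fractional_laplacian_def)
  moreover have "1 / Gamma (- s) * (- w * S) = 1 / h powr (2 * s) * S" for S
  proof -
    have "c powr s = 1 / h powr (2 * s)"
      using h by (simp add: c_def powr_divide powr_powr flip: powr_numeral)
    then show ?thesis
      using Gamma_minus_neg[OF s] by (simp add: w_def)
  qed
  ultimately show ?eq by simp
qed

section \<open>The limits for small and large exponents\<close>

lemma abs_infsum_le_cmult:
  fixes f g :: "'a \<Rightarrow> real"
  assumes "(\<lambda>m. \<bar>f m\<bar>) summable_on A" "g summable_on A" "\<And>m. m \<in> A \<Longrightarrow> \<bar>f m\<bar> \<le> C * g m"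
  shows "\<bar>infsum f A\<bar> \<le> C * infsum g A"
proof -
  have "\<bar>infsum f A\<bar> \<le> (\<Sum>\<^sub>\<infinity>m\<in>A. \<bar>f m\<bar>)"
    using norm_infsum_bound[of f A] assms(1) by simp
  also have "\<dots> \<le> (\<Sum>\<^sub>\<infinity>m\<in>A. C * g m)"
    using assms by (intro infsum_mono summable_on_cmult_right)
  also have "\<dots> = C * infsum g A"
    by (rule infsum_cmult_right')
  finally show ?thesis .
qed

text \<open>
  Splitting the formula into \<open>u j * S s - R s\<close>, the mass \<open>S s\<close> of the kernel tends to \<open>1\<close>. For
  \<open>s < 1/2\<close> one has \<open>\<bar>j - m\<bar> - s \<ge> \<bar>j - m\<bar> / 2\<close>, so \<open>K\<^sub>s(j - m) \<le> 4 kernel_constant s / \<bar>j - m\<bar>\<close>;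
  against this weight \<open>u \<in> \<ell>\<^sub>0\<close> is summable, hence \<open>R s\<close> is at most a constant times \<open>kernel_constant s\<close>.
\<close>

lemma tendsto_fractional_laplacian_0:
  assumes h: "h > 0" and u: "u \<in> ell 0"
  shows "((\<lambda>s. fractional_laplacian h s u j) \<longlongrightarrow> u j) (at_right 0)"
proof -
  define S where "S = (\<lambda>s::real. 4 powr s * Gamma (1 / 2 + s) / (sqrt pi * Gamma (1 + s)))"
  define R where "R = (\<lambda>s. \<Sum>\<^sub>\<infinity>m\<in>UNIV - {j}. u m * discrete_kernel s (j - m))"
  define g where "g = (\<lambda>m. if m = j then 0 else 4 / \<bar>real_of_int (j - m)\<bar>)"
  define D where "D = (\<Sum>\<^sub>\<infinity>m\<in>UNIV - {j}. \<bar>g m * u m\<bar>)"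
  have near_0: "eventually (\<lambda>s. 0 < s \<and> s < 1 / 2) (at_right (0::real))"
    by (intro eventually_conj eventually_at_right_less) (auto simp: eventually_at_right_field intro!: exI[of _ "1 / 2"])
  have "isCont S 0"
    unfolding S_def by (intro continuous_intros) (auto elim!: nonpos_Ints_cases simp: Gamma_eq_zero_iff)
  moreover have "S 0 = 1"
    by (simp add: S_def Gamma_one_half_real)
  ultimately have S_lim: "(S \<longlongrightarrow> 1) (at_right 0)"
    using isCont_tendsto_within[of 0 S] by simp
  have "\<bar>g m\<bar> * (1 + \<bar>real_of_int (j - m)\<bar>) powr (1 + 2 * 0) \<le> 8" for m
  proof (cases "m = j")
    case False
    then have "\<bar>real_of_int (j - m)\<bar> \<ge> 1" by (intro abs_int_ge_1) auto
    with False show ?thesis by (simp add: g_def divide_simps)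
  qed (simp add: g_def)
  from ell_mult_abs_summable[OF u order_refl this]
  have g_summable: "(\<lambda>m. \<bar>g m * u m\<bar>) summable_on (UNIV - {j})"
    by (rule summable_on_subset_banach) auto
  have R_le: "\<bar>R s\<bar> \<le> kernel_constant s * D" if s: "0 < s" "s < 1 / 2" for s
    unfolding R_def D_def
  proof (rule abs_infsum_le_cmult[OF _ g_summable])
    show "(\<lambda>m. \<bar>u m * discrete_kernel s (j - m)\<bar>) summable_on (UNIV - {j})"
      using ell_mono[OF u, of s] s by (intro discrete_kernel_mult_abs_summable) auto
    fix m assume m: "m \<in> UNIV - {j}"
    define x where "x = \<bar>real_of_int (j - m)\<bar>"
    have x: "x \<ge> 1"
      unfolding x_def using m by (intro abs_int_ge_1) auto
    have "(x - s) powr (- (1 + 2 * s)) \<le> (x / 2) powr (- (1 + 2 * s))"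
      using x s by (intro powr_mono2') auto
    also have "\<dots> = 2 powr (1 + 2 * s) / x powr (1 + 2 * s)"
      unfolding powr_minus_divide using x by (simp add: powr_divide)
    also have "\<dots> \<le> 2 powr 2 / x powr 1"
      using x s by (intro frac_le powr_mono) auto
    also have "\<dots> = g m"
      using m x by (simp add: g_def x_def)
    finally have "kernel_constant s * (x - s) powr (- (1 + 2 * s)) \<le> kernel_constant s * g m"
      using kernel_constant_pos[of s] s by (intro mult_left_mono) auto
    then have "discrete_kernel s (j - m) \<le> kernel_constant s * g m"
      using discrete_kernel_le[of s "j - m"] m s by (simp add: x_def)
    from mult_right_mono[OF this, of "\<bar>u m\<bar>"]
    show "\<bar>u m * discrete_kernel s (j - m)\<bar> \<le> kernel_constant s * \<bar>g m * u m\<bar>"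
      using discrete_kernel_nonneg[of s "j - m"] m s by (simp add: abs_mult g_def mult_ac)
  qed
  have "(R \<longlongrightarrow> 0) (at_right 0)"
  proof (rule Lim_null_comparison)
    show "eventually (\<lambda>s. norm (R s) \<le> kernel_constant s * D) (at_right 0)"
      using near_0 by eventually_elim (use R_le in auto)
    show "((\<lambda>s. kernel_constant s * D) \<longlongrightarrow> 0) (at_right 0)"
      using tendsto_mult_right[OF kernel_constant_tendsto_0(1), of D] by simp
  qed
  moreover have "((\<lambda>s. 1 / h powr (2 * s)) \<longlongrightarrow> 1) (at_right 0)"
  proof -
    have "isCont (\<lambda>s. 1 / h powr (2 * s)) 0"
      using h by (intro continuous_intros) auto
    from isCont_tendsto_within[OF this] show ?thesis
      using h by simp
  qed
  ultimately have "((\<lambda>s. 1 / h powr (2 * s) * (u j * S s - R s)) \<longlongrightarrow> 1 * (u j * 1 - 0)) (at_right 0)"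
    by (intro tendsto_intros S_lim)
  moreover have "eventually (\<lambda>s. fractional_laplacian h s u j =
      1 / h powr (2 * s) * (u j * S s - R s)) (at_right 0)"
    using near_0
  proof eventually_elim
    case (elim s)
    then have s: "0 < s" "s < 1" and us: "u \<in> ell s"
      using ell_mono[OF u, of s] by auto
    have "((\<lambda>m. discrete_kernel s (j - m)) has_sum S s) (UNIV - {j})"
      using discrete_kernel_has_sum[OF s] unfolding S_def
      by (subst has_sum_reindex_bij_witness[of _ "\<lambda>m. j - m" "\<lambda>m. j - m" "UNIV - {0}" "discrete_kernel s"]) auto
    then have "((\<lambda>m. u j * discrete_kernel s (j - m)) has_sum (u j * S s)) (UNIV - {j})"
      by (rule has_sum_cmult_right)
    moreover have "((\<lambda>m. - 1 * (u m * discrete_kernel s (j - m))) has_sum (- 1 * R s)) (UNIV - {j})"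
      unfolding R_def using discrete_kernel_mult_abs_summable[OF us s, of j]
      by (intro has_sum_cmult_right has_sum_infsum) (subst summable_on_iff_abs_summable_on_real, simp)
    ultimately have "((\<lambda>m. u j * discrete_kernel s (j - m) + - 1 * (u m * discrete_kernel s (j - m)))
        has_sum (u j * S s + - 1 * R s)) (UNIV - {j})"
      by (rule has_sum_add)
    then have "(\<Sum>\<^sub>\<infinity>m\<in>UNIV - {j}. (u j - u m) * discrete_kernel s (j - m)) = u j * S s - R s"
      by (intro infsumI) (simp add: left_diff_distrib)
    then show ?case
      using fractional_laplacian_pointwise(2)[OF us s h] by simp
  qed
  ultimately show ?thesis
    by (simp add: tendsto_cong)
qed

text \<open>
  For \<open>\<bar>j - m\<bar> \<ge> 2\<close> one has \<open>\<bar>j - m\<bar> - s \<ge> \<bar>j - m\<bar> / 2 \<ge> 1\<close>, so for \<open>s > 1/2\<close> the exponent \<open>- (1 + 2 s)\<close> may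
  be raised to \<open>- 2\<close> and \<open>K\<^sub>s(j - m) \<le> 4 kernel_constant s / \<bar>j - m\<bar>\<^sup>2\<close>. The differences \<open>u j - u m\<close> are
  bounded, so these terms contribute at most a constant times \<open>kernel_constant s\<close>, which tends to \<open>0\<close>.
  Only \<open>m = j - 1\<close> and \<open>m = j + 1\<close> remain, with weight \<open>K\<^sub>s(1) \<rightarrow> 1\<close>.
\<close>

lemma tendsto_fractional_laplacian_1:
  assumes h: "h > 0" and u: "u \<in> ell_infinity"
  shows "((\<lambda>s. fractional_laplacian h s u j) \<longlongrightarrow> - discrete_laplacian h u j) (at_left 1)"
proof -
  define v where "v = (\<lambda>m. u j - u m)"
  define A where "A = UNIV - {j - 1, j, j + 1}"
  define R where "R = (\<lambda>s. \<Sum>\<^sub>\<infinity>m\<in>A. v m * discrete_kernel s (j - m))"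
  define g where "g = (\<lambda>m. if m = j then 0 else 4 / \<bar>real_of_int (j - m)\<bar>\<^sup>2)"
  define D where "D = (\<Sum>\<^sub>\<infinity>m\<in>A. \<bar>g m * v m\<bar>)"
  have near_1: "eventually (\<lambda>s. s \<in> {1 / 2<..<1}) (at_left (1::real))"
    by (rule eventually_at_left_real) simp
  have "v \<in> ell (1 / 2)"
  proof (rule bounded_mem_ell)
    from u obtain B where B: "\<And>m. \<bar>u m\<bar> \<le> B"
      by (auto simp: ell_infinity_def bounded_iff)
    have "norm (v m) \<le> B + B" for m
      using B[of j] B[of m] by (simp add: v_def)
    then show "v \<in> ell_infinity"
      by (auto simp: ell_infinity_def bounded_iff)
  qed simp
  moreover have "\<bar>g m\<bar> * (1 + \<bar>real_of_int (j - m)\<bar>) powr (1 + 2 * (1 / 2)) \<le> 16" for m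
  proof (cases "m = j")
    case False
    define x where "x = \<bar>real_of_int (j - m)\<bar>"
    have x: "x \<ge> 1"
      unfolding x_def using False by (intro abs_int_ge_1) auto
    then have "(1 + x)\<^sup>2 \<le> (2 * x)\<^sup>2"
      by (intro power_mono) auto
    then have "4 / x\<^sup>2 * (1 + x)\<^sup>2 \<le> 16"
      using x by (simp add: divide_simps power_mult_distrib)
    moreover have "g m = 4 / x\<^sup>2" "(1 + x) powr (1 + 2 * (1 / 2)) = (1 + x)\<^sup>2"
      using False x by (simp_all add: g_def x_def)
    ultimately show ?thesis
      unfolding x_def [symmetric] by simp
  qed (simp add: g_def)
  ultimately have "(\<lambda>m. \<bar>g m * v m\<bar>) summable_on UNIV"
    by (intro ell_mult_abs_summable[of v "1 / 2" g j]) auto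
  then have g_summable: "(\<lambda>m. \<bar>g m * v m\<bar>) summable_on A"
    by (rule summable_on_subset_banach) auto
  have R_le: "\<bar>R s\<bar> \<le> kernel_constant s * D" if s: "s \<in> {1 / 2<..<1}" for s
    unfolding R_def D_def
  proof (rule abs_infsum_le_cmult[OF _ g_summable])
    have "(\<lambda>m. \<bar>v m * discrete_kernel s (j - m)\<bar>) summable_on (UNIV - {j})"
      unfolding v_def using bounded_mem_ell[OF u, of s] s by (intro kernel_differences_summable) auto
    then show "(\<lambda>m. \<bar>v m * discrete_kernel s (j - m)\<bar>) summable_on A"
      by (rule summable_on_subset_banach) (auto simp: A_def)
    fix m assume m: "m \<in> A"
    define x where "x = \<bar>real_of_int (j - m)\<bar>"
    have x: "x \<ge> 2"
      using m unfolding x_def A_def by auto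
    have "(x - s) powr (- (1 + 2 * s)) \<le> (x / 2) powr (- (1 + 2 * s))"
      using x s by (intro powr_mono2') auto
    also have "\<dots> \<le> (x / 2) powr (- 2)"
      using x s by (intro powr_mono) auto
    also have "\<dots> = g m"
      using m x unfolding powr_minus_divide
      by (simp add: g_def A_def power_divide x_def)
    finally have "kernel_constant s * (x - s) powr (- (1 + 2 * s)) \<le> kernel_constant s * g m"
      using kernel_constant_pos[of s] s by (intro mult_left_mono) auto
    then have "discrete_kernel s (j - m) \<le> kernel_constant s * g m"
      using discrete_kernel_le[of s "j - m"] m s by (simp add: x_def A_def)
    from mult_right_mono[OF this, of "\<bar>v m\<bar>"]
    show "\<bar>v m * discrete_kernel s (j - m)\<bar> \<le> kernel_constant s * \<bar>g m * v m\<bar>"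
      using discrete_kernel_nonneg[of s "j - m"] m s by (simp add: abs_mult g_def A_def mult_ac)
  qed
  have "(R \<longlongrightarrow> 0) (at_left 1)"
  proof (rule Lim_null_comparison)
    show "eventually (\<lambda>s. norm (R s) \<le> kernel_constant s * D) (at_left 1)"
      using near_1 by eventually_elim (use R_le in auto)
    show "((\<lambda>s. kernel_constant s * D) \<longlongrightarrow> 0) (at_left 1)"
      using tendsto_mult_right[OF kernel_constant_tendsto_0(2), of D] by simp
  qed
  moreover have "((\<lambda>s. 1 / h powr (2 * s)) \<longlongrightarrow> 1 / h\<^sup>2) (at_left 1)"
  proof -
    have "isCont (\<lambda>s. 1 / h powr (2 * s)) 1"
      using h by (intro continuous_intros) auto
    from isCont_tendsto_within[OF this] show ?thesis
      using h by simp
  qed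
  ultimately have "((\<lambda>s. 1 / h powr (2 * s) * ((v (j - 1) + v (j + 1)) * discrete_kernel s 1 + R s))
      \<longlongrightarrow> 1 / h\<^sup>2 * ((v (j - 1) + v (j + 1)) * 1 + 0)) (at_left 1)"
    by (intro tendsto_mult tendsto_add tendsto_const discrete_kernel_1_tendsto)
  also have "1 / h\<^sup>2 * ((v (j - 1) + v (j + 1)) * 1 + 0) = - discrete_laplacian h u j"
    by (simp add: discrete_laplacian_def v_def diff_divide_distrib add_divide_distrib)
  finally have lim: "((\<lambda>s. 1 / h powr (2 * s) * ((v (j - 1) + v (j + 1)) * discrete_kernel s 1 + R s))
      \<longlongrightarrow> - discrete_laplacian h u j) (at_left 1)" .
  have "eventually (\<lambda>s. fractional_laplacian h s u j =
      1 / h powr (2 * s) * ((v (j - 1) + v (j + 1)) * discrete_kernel s 1 + R s)) (at_left 1)"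
    using near_1
  proof eventually_elim
    case (elim s)
    then have s: "0 < s" "s < 1" and us: "u \<in> ell s"
      using bounded_mem_ell[OF u, of s] by auto
    have summable: "(\<lambda>m. v m * discrete_kernel s (j - m)) summable_on (UNIV - {j})"
      unfolding v_def by (rule kernel_term_summable[OF us s])
    have "UNIV - {j} = {j - 1, j + 1} \<union> A"
      by (auto simp: A_def)
    then have "(\<Sum>\<^sub>\<infinity>m\<in>UNIV - {j}. v m * discrete_kernel s (j - m)) =
        (\<Sum>\<^sub>\<infinity>m\<in>{j - 1, j + 1} \<union> A. v m * discrete_kernel s (j - m))"
      by simp
    also have "\<dots> = (\<Sum>\<^sub>\<infinity>m\<in>{j - 1, j + 1}. v m * discrete_kernel s (j - m)) + R s"
      unfolding R_def
      by (intro infsum_Un_disjoint summable_on_subset_banach[OF summable]) (auto simp: A_def)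
    also have "(\<Sum>\<^sub>\<infinity>m\<in>{j - 1, j + 1}. v m * discrete_kernel s (j - m)) =
        (v (j - 1) + v (j + 1)) * discrete_kernel s 1"
      using discrete_kernel_even[of s 1] by (simp add: algebra_simps)
    finally show ?case
      using fractional_laplacian_pointwise(2)[OF us s h] by (simp add: v_def)
  qed
  with lim show ?thesis
    by (simp add: tendsto_cong)
qed

theorem theorem1p2:
  fixes h :: real
  assumes "h > 0"
  shows
    "(\<forall>s u j. 0 < s \<and> s < 1 \<and> u \<in> ell s \<longrightarrow>
        (\<forall>t\<ge>0. (\<lambda>m. heat_kernel (j - m) (t / h\<^sup>2) * u m) summable_on UNIV) \<and>
        set_integrable lborel {0<..} (\<lambda>t. (heat_semigroup h t u j - u j) / t powr (1 + s)) \<and>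
        (\<lambda>m. (u j - u m) * discrete_kernel s (j - m)) summable_on (UNIV - {j}) \<and>
        fractional_laplacian h s u j =
          1 / h powr (2 * s) *
            (\<Sum>\<^sub>\<infinity>m\<in>UNIV - {j}. (u j - u m) * discrete_kernel s (j - m)))
     \<and> (\<forall>u\<in>ell 0. \<forall>j. ((\<lambda>s. fractional_laplacian h s u j) \<longlongrightarrow> u j) (at_right 0))
     \<and> (\<forall>u\<in>ell_infinity. \<forall>j.
          ((\<lambda>s. fractional_laplacian h s u j) \<longlongrightarrow> - discrete_laplacian h u j) (at_left 1))
     \<and> (\<forall>s. 0 < s \<and> s < 1 \<longrightarrow>
          (\<exists>C>0. \<forall>m. m \<noteq> 0 \<longrightarrow>
             discrete_kernel s m \<le> C / \<bar>real_of_int m\<bar> powr (1 + 2 * s)))"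
proof (intro conjI)
  show "\<forall>s u j. 0 < s \<and> s < 1 \<and> u \<in> ell s \<longrightarrow>
        (\<forall>t\<ge>0. (\<lambda>m. heat_kernel (j - m) (t / h\<^sup>2) * u m) summable_on UNIV) \<and>
        set_integrable lborel {0<..} (\<lambda>t. (heat_semigroup h t u j - u j) / t powr (1 + s)) \<and>
        (\<lambda>m. (u j - u m) * discrete_kernel s (j - m)) summable_on (UNIV - {j}) \<and>
        fractional_laplacian h s u j =
          1 / h powr (2 * s) *
            (\<Sum>\<^sub>\<infinity>m\<in>UNIV - {j}. (u j - u m) * discrete_kernel s (j - m))"
  proof (intro allI impI conjI)
    fix s u j and t :: real
    assume "0 < s \<and> s < 1 \<and> u \<in> ell s" "t \<ge> 0"
    then show "(\<lambda>m. heat_kernel (j - m) (t / h\<^sup>2) * u m) summable_on UNIV"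
      by (intro heat_kernel_mult_summable[of u s]) auto
  qed (use assms fractional_laplacian_pointwise kernel_term_summable in blast)+
  show "\<forall>s. 0 < s \<and> s < 1 \<longrightarrow> (\<exists>C>0. \<forall>m. m \<noteq> 0 \<longrightarrow>
      discrete_kernel s m \<le> C / \<bar>real_of_int m\<bar> powr (1 + 2 * s))"
  proof (intro allI impI)
    fix s :: real
    assume "0 < s \<and> s < 1"
    then show "\<exists>C>0. \<forall>m. m \<noteq> 0 \<longrightarrow> discrete_kernel s m \<le> C / \<bar>real_of_int m\<bar> powr (1 + 2 * s)"
      using discrete_kernel_decay[of s] kernel_constant_pos[of s]
      by (intro exI[of _ "kernel_constant s * (1 - s) powr (- (1 + 2 * s))"]) auto
  qed
qed (use assms tendsto_fractional_laplacian_0 tendsto_fractional_laplacian_1 in blast)+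

end
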